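(* Let $a,b,c,d>0$ and let $\{W_n(z)\}_{n\ge0}$ be defined by $W_0(z)=1$, $W_1(z)=z$, $W_n(z)=(az+b)W_{n-1}(z)+(cz+d)W_{n-2}(z)$ for $n\ge2$. Let $\Delta_\Delta=-a^2d+abc+c^2$, $\Delta_g=(b+c)^2+4d(1-a)$, \[ x_\Delta^{\pm}=\frac{-ab-2c\pm2\sqrt{\Delta_\Delta}}{a^2},\qquad x_g^\pm=\begin{cases}\dfrac{b+c}{2(1-a)}\pm\dfrac{\sqrt{\Delta_g}}{2|1-a|},&a\ne1,\\[8pt] -\dfrac{d}{b+c},&a=1.\end{cases} \] (so $x_\Delta^\pm$ are the two roots, possibly complex, of $a^2z^2+(2ab+4c)z+b^2+4d$). Then the points $-b/a$, $x_\Delta^+$ and $x_\Delta^-$ are non-isolated limits of zeros of $\{W_n(z)\}_n$. Moreover, if $ad<bc$, then the set of limits of zeros of $\{W_n(z)\}_n$ equals \[ \mathcal{L}^*=\begin{cases} [x_\Delta^-,\,x_\Delta^+]\cup\{x_g^-\}, &\text{if } 0<a\le 1;\\ [x_\Delta^-,\,x_\Delta^+]\cup\{x_g^+\}, &\text{if either } 1<a\le 2, \text{ or } a>2 \text{ and } \Delta_\Delta\le\Delta_g;\\ [x_\Delta^-,\,x_\Delta^+]\cup\{x_g^-,x_g^+\}, &\text{if } a>2 \text{ and } \Delta_\Delta>\Delta_g. \end{cases} \]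
   Context: A complex number $x$ is a limit of zeros of $\{W_n(z)\}_n$ if for every $n\ge1$ there is a zero $z_n$ of $W_n(z)$ such that $\lim_{n\to\infty}z_n=x$. Such a limit $x$ is non-isolated if $x$ is an accumulation point of the set of all limits of zeros of $\{W_n(z)\}_n$. When $ad\le bc$ one has $\Delta_\Delta>0$ and $\Delta_g>0$, so $x_\Delta^\pm,x_g^\pm$ are real and $x_\Delta^-<-b/a<x_\Delta^+$. *)

theory Defs
  imports "HOL-Analysis.Analysis"
begin

fun W :: "real \<Rightarrow> real \<Rightarrow> real \<Rightarrow> real \<Rightarrow> nat \<Rightarrow> complex \<Rightarrow> complex" where
  "W a b c d 0 z = 1"
| "W a b c d (Suc 0) z = z"
| "W a b c d (Suc (Suc n)) z =
     (of_real a * z + of_real b) * W a b c d (Suc n) z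
     + (of_real c * z + of_real d) * W a b c d n z"

definition limits_of_zeros :: "(nat \<Rightarrow> complex \<Rightarrow> complex) \<Rightarrow> complex set" where
  "limits_of_zeros f = {x. \<exists>z. (\<forall>n\<ge>1. f n (z n) = 0) \<and> z \<longlonglongrightarrow> x}"

definition nonisolated_limit_of_zeros :: "(nat \<Rightarrow> complex \<Rightarrow> complex) \<Rightarrow> complex \<Rightarrow> bool" where
  "nonisolated_limit_of_zeros f x \<longleftrightarrow>
     x \<in> limits_of_zeros f \<and> x islimpt limits_of_zeros f"

definition Delta_Delta :: "real \<Rightarrow> real \<Rightarrow> real \<Rightarrow> real \<Rightarrow> real" where
  "Delta_Delta a b c d = - (a\<^sup>2 * d) + a * b * c + c\<^sup>2"

definition Delta_g :: "real \<Rightarrow> real \<Rightarrow> real \<Rightarrow> real \<Rightarrow> real" where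
  "Delta_g a b c d = (b + c)\<^sup>2 + 4 * d * (1 - a)"

text \<open>
  The discriminants may be negative, so the four points below are complex numbers and the square
  root is \<open>csqrt\<close>: it agrees with the real square root for a nonnegative argument and is
  \<open>\<i> * sqrt (- D)\<close> for \<open>D < 0\<close>.
\<close>

definition x_Delta_plus :: "real \<Rightarrow> real \<Rightarrow> real \<Rightarrow> real \<Rightarrow> complex" where
  "x_Delta_plus a b c d =
     (of_real (- a * b - 2 * c) + 2 * csqrt (of_real (Delta_Delta a b c d))) / of_real (a\<^sup>2)"

definition x_Delta_minus :: "real \<Rightarrow> real \<Rightarrow> real \<Rightarrow> real \<Rightarrow> complex" where
  "x_Delta_minus a b c d =
     (of_real (- a * b - 2 * c) - 2 * csqrt (of_real (Delta_Delta a b c d))) / of_real (a\<^sup>2)"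

definition x_g_plus :: "real \<Rightarrow> real \<Rightarrow> real \<Rightarrow> real \<Rightarrow> complex" where
  "x_g_plus a b c d =
     (if a \<noteq> 1
      then of_real ((b + c) / (2 * (1 - a)))
           + csqrt (of_real (Delta_g a b c d)) / of_real (2 * \<bar>1 - a\<bar>)
      else of_real (- d / (b + c)))"

definition x_g_minus :: "real \<Rightarrow> real \<Rightarrow> real \<Rightarrow> real \<Rightarrow> complex" where
  "x_g_minus a b c d =
     (if a \<noteq> 1
      then of_real ((b + c) / (2 * (1 - a)))
           - csqrt (of_real (Delta_g a b c d)) / of_real (2 * \<bar>1 - a\<bar>)
      else of_real (- d / (b + c)))"

text \<open>
  The set below is used for \<open>a * d < b * c\<close> only. Then \<open>x_Delta_minus\<close> and \<open>x_Delta_plus\<close> are real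
  and the closed segment between them is the real interval, see \<open>closed_segment_x_Delta\<close>.
\<close>

definition L_star :: "real \<Rightarrow> real \<Rightarrow> real \<Rightarrow> real \<Rightarrow> complex set" where
  "L_star a b c d =
     closed_segment (x_Delta_minus a b c d) (x_Delta_plus a b c d) \<union>
     (if 0 < a \<and> a \<le> 1 then {x_g_minus a b c d}
      else if (1 < a \<and> a \<le> 2) \<or> (a > 2 \<and> Delta_Delta a b c d \<le> Delta_g a b c d)
      then {x_g_plus a b c d}
      else {x_g_minus a b c d, x_g_plus a b c d})"

lemma x_Delta_roots:
  assumes "a > 0"
  shows "of_real (a\<^sup>2) * z\<^sup>2 + of_real (2 * a * b + 4 * c) * z + of_real (b\<^sup>2 + 4 * d) =
           of_real (a\<^sup>2) * (z - x_Delta_plus a b c d) * (z - x_Delta_minus a b c d)"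
proof -
  define s where "s = csqrt (of_real (Delta_Delta a b c d))"
  define A B C D :: complex
    where "A = of_real a" and "B = of_real b" and "C = of_real c" and "D = of_real d"
  have s: "s\<^sup>2 = - (A\<^sup>2 * D) + A * B * C + C\<^sup>2"
    by (simp add: s_def Delta_Delta_def A_def B_def C_def D_def)
  have A: "A \<noteq> 0" using assms by (simp add: A_def)
  define p m where "p = x_Delta_plus a b c d" and "m = x_Delta_minus a b c d"
  have p: "A\<^sup>2 * p = - A * B - 2 * C + 2 * s" and m: "A\<^sup>2 * m = - A * B - 2 * C - 2 * s"
    using A by (simp_all add: p_def m_def x_Delta_plus_def x_Delta_minus_def s_def A_def B_def C_def)
  have "4 * (A\<^sup>2 * D + s\<^sup>2) = 4 * (A * B * C + C\<^sup>2)"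
    using s by simp
  then have "A\<^sup>2 * (A\<^sup>2 * z\<^sup>2 + (2 * A * B + 4 * C) * z + (B\<^sup>2 + 4 * D)) =
        (A\<^sup>2 * z - (- A * B - 2 * C + 2 * s)) * (A\<^sup>2 * z - (- A * B - 2 * C - 2 * s))"
    by (simp add: power2_eq_square ring_distribs) (simp add: algebra_simps)
  also have "\<dots> = (A\<^sup>2 * z - A\<^sup>2 * p) * (A\<^sup>2 * z - A\<^sup>2 * m)"
    by (simp only: p m)
  also have "\<dots> = A\<^sup>2 * (A\<^sup>2 * (z - p) * (z - m))"
    by (simp add: algebra_simps)
  finally have "A\<^sup>2 * z\<^sup>2 + (2 * A * B + 4 * C) * z + (B\<^sup>2 + 4 * D) = A\<^sup>2 * (z - p) * (z - m)"
    using A by simp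
  then show ?thesis
    by (simp add: p_def m_def A_def B_def C_def D_def)
qed

lemma closed_segment_x_Delta:
  assumes "a > 0" "b > 0" "c > 0" "d > 0" "a * d < b * c"
  shows "closed_segment (x_Delta_minus a b c d) (x_Delta_plus a b c d) =
           of_real ` {(- a * b - 2 * c - 2 * sqrt (Delta_Delta a b c d)) / a\<^sup>2 ..
                      (- a * b - 2 * c + 2 * sqrt (Delta_Delta a b c d)) / a\<^sup>2}"
proof -
  have "a * (a * d) < a * (b * c)"
    using assms by (intro mult_strict_left_mono)
  moreover have "c\<^sup>2 > 0"
    using assms by simp
  ultimately have pos: "Delta_Delta a b c d > 0"
    by (simp add: Delta_Delta_def power2_eq_square mult.assoc)
  then have cs: "csqrt (of_real (Delta_Delta a b c d)) = of_real (sqrt (Delta_Delta a b c d))"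
    by (intro csqrt_of_real) simp
  have le: "(- a * b - 2 * c - 2 * sqrt (Delta_Delta a b c d)) / a\<^sup>2 \<le>
            (- a * b - 2 * c + 2 * sqrt (Delta_Delta a b c d)) / a\<^sup>2"
    using pos by (intro divide_right_mono) auto
  have m: "x_Delta_minus a b c d =
             of_real ((- a * b - 2 * c - 2 * sqrt (Delta_Delta a b c d)) / a\<^sup>2)"
    and p: "x_Delta_plus a b c d =
             of_real ((- a * b - 2 * c + 2 * sqrt (Delta_Delta a b c d)) / a\<^sup>2)"
    by (simp_all add: x_Delta_minus_def x_Delta_plus_def cs)
  show ?thesis
    unfolding m p closed_segment_of_real using le by (simp only: closed_segment_eq_real_ivl if_True)
qed

end

theory Submission
  imports Defs "HOL-Complex_Analysis.Complex_Analysis"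
    "HOL-Computational_Algebra.Fundamental_Theorem_Algebra"
begin

text \<open>
  Put \<open>A z = a z + b\<close>, \<open>B z = c z + d\<close>, and let \<open>l1\<close>, \<open>l2\<close> be the roots of \<open>t\<^sup>2 = A z t + B z\<close>, so that
  \<open>(l1 - l2) W\<^sub>n z = (z - l2) l1 ^ n - (z - l1) l2 ^ n\<close>. Where the moduli of the roots agree, the zeros of \<open>W\<^sub>n\<close>
  are the solutions of \<open>q ^ n h = 1\<close> with \<open>\<bar>q\<bar> = 1\<close>; taking logarithms and applying Hurwitz' theorem,
  they accumulate at every such point. Where \<open>\<bar>l2\<bar> < \<bar>l1\<bar>\<close>, the first term dominates, and by
  Hurwitz' theorem again the point is a limit of zeros iff \<open>z = l2\<close>. The moduli agree iff
  \<open>(A z)\<^sup>2 + t B z = 0\<close> for some \<open>t \<in> [0, 4]\<close>, where \<open>t = 0\<close> gives \<open>- b / a\<close> and \<open>t = 4\<close> gives the points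
  \<open>x_Delta\<close>; these are not isolated because \<open>- A\<^sup>2 / B\<close> is an open map. For \<open>a d < b c\<close> the curve is the
  real segment between the points \<open>x_Delta\<close>, and \<open>z = l2\<close> means that \<open>z\<close> is a zero \<open>x_g\<close> of
  \<open>z\<^sup>2 - A z z - B z\<close> with \<open>\<bar>z\<bar> < \<bar>A z - z\<bar>\<close>.
\<close>

section \<open>Hurwitz' theorem and the equation \<open>q ^ n * h = 1\<close>\<close>

text \<open>If this failed, a subsequence would have no zeros in a small ball around
  \<open>z0\<close>, and Hurwitz' theorem on that ball would give \<open>g z0 \<noteq> 0\<close>.
  The identity theorem ensures that \<open>g\<close> is not constant on the ball either.\<close>

lemma Hurwitz_eventually_zero:
  fixes f :: "nat \<Rightarrow> complex \<Rightarrow> complex"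
  assumes S: "open S" "connected S"
    and holf: "\<And>n. f n holomorphic_on S" and holg: "g holomorphic_on S"
    and lim: "\<And>K. compact K \<Longrightarrow> K \<subseteq> S \<Longrightarrow> uniform_limit K f g sequentially"
    and nonconst: "\<not> g constant_on S"
    and z0: "z0 \<in> S" "g z0 = 0" and e: "e > 0"
  shows "\<forall>\<^sub>F n in sequentially. \<exists>z\<in>S \<inter> ball z0 e. f n z = 0"
proof (rule ccontr)
  assume "\<not> ?thesis"
  then have "\<exists>\<^sub>\<infinity>n. \<forall>z\<in>S \<inter> ball z0 e. f n z \<noteq> 0"
    by (simp add: not_eventually cofinite_eq_sequentially)
  then have inf: "infinite {n. \<forall>z\<in>S \<inter> ball z0 e. f n z \<noteq> 0}"
    by (simp add: frequently_cofinite)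
  obtain r :: "nat \<Rightarrow> nat" where "strict_mono r" "\<And>n. r n \<in> {n. \<forall>z\<in>S \<inter> ball z0 e. f n z \<noteq> 0}"
    using infinite_enumerate[OF inf] by blast
  then have r: "strict_mono r" "\<And>n z. z \<in> S \<inter> ball z0 e \<Longrightarrow> f (r n) z \<noteq> 0"
    by simp_all
  obtain \<epsilon> where \<epsilon>: "\<epsilon> > 0" "ball z0 \<epsilon> \<subseteq> S \<inter> ball z0 e"
    using S(1) z0(1) e by (meson Int_iff centre_in_ball open_Int open_ball open_contains_ball)
  have "\<not> g constant_on ball z0 \<epsilon>"
  proof
    assume "g constant_on ball z0 \<epsilon>"
    then obtain k where k: "\<And>z. z \<in> ball z0 \<epsilon> \<Longrightarrow> g z = k"
      by (auto simp: constant_on_def)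
    have "g z = k" if "z \<in> S" for z
      by (rule analytic_continuation_open[of "ball z0 \<epsilon>" S g "\<lambda>_. k"])
        (use \<epsilon> S holg k that in auto)
    then show False
      using nonconst by (auto simp: constant_on_def)
  qed
  moreover have "uniform_limit K (\<lambda>n. f (r n)) g sequentially"
    if "compact K" "K \<subseteq> ball z0 \<epsilon>" for K
    using lim[of K] that \<epsilon>(2) filterlim_subseq[OF r(1)]
    by (simp add: le_infI1 subset_eq) (rule filterlim_compose, assumption+)
  ultimately have "g z0 \<noteq> 0"
    using \<epsilon> r(2) holomorphic_on_subset[OF holf] holomorphic_on_subset[OF holg]
    by (intro Hurwitz_no_zeros[of "ball z0 \<epsilon>" "\<lambda>n. f (r n)" g z0]) (simp_all add: subset_eq)
  with z0 show False by simp
qed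

text \<open>With logarithms \<open>q = exp \<theta>\<close> and \<open>h = exp \<eta>\<close> on the
  disc, it suffices that \<open>n * \<theta> + \<eta>\<close> equals
  \<open>2 * pi * \<i> * k n\<close> for some integer \<open>k n\<close>. After division by
  \<open>n\<close>, a suitable choice of \<open>k n\<close> makes the difference of the two sides
  converge to \<open>\<theta> z - \<theta> z0\<close>, which vanishes at \<open>z0\<close>, so
  Hurwitz' theorem applies.\<close>

lemma eventually_power_mult_eq_1:
  fixes q h :: "complex \<Rightarrow> complex"
  assumes r: "r > 0"
    and hol: "q holomorphic_on ball z0 r" "h holomorphic_on ball z0 r"
    and nz: "\<And>z. z \<in> ball z0 r \<Longrightarrow> q z \<noteq> 0" "\<And>z. z \<in> ball z0 r \<Longrightarrow> h z \<noteq> 0"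
    and nonconst: "\<not> q constant_on ball z0 r"
    and unit: "norm (q z0) = 1" and e: "e > 0"
  shows "\<forall>\<^sub>F n in sequentially. \<exists>z\<in>ball z0 r \<inter> ball z0 e. q z ^ n * h z = 1"
proof -
  let ?D = "ball z0 r"
  obtain \<theta> where \<theta>: "\<theta> holomorphic_on ?D" "\<And>z. z \<in> ?D \<Longrightarrow> q z = exp (\<theta> z)"
    using contractible_imp_holomorphic_log[OF hol(1) convex_imp_contractible[OF convex_ball] nz(1)]
    by metis
  obtain \<eta> where \<eta>: "\<eta> holomorphic_on ?D" "\<And>z. z \<in> ?D \<Longrightarrow> h z = exp (\<eta> z)"
    using contractible_imp_holomorphic_log[OF hol(2) convex_imp_contractible[OF convex_ball] nz(2)]
    by metis
  \<comment> \<open>Since the modulus of \<open>q z0\<close> is 1, \<open>\<theta> z0\<close> is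
    purely imaginary; rounding down makes \<open>2 * pi * \<i> * k n / n\<close> tend to it.\<close>
  define k :: "nat \<Rightarrow> int" where "k n = \<lfloor>real n * Im (\<theta> z0) / (2 * pi)\<rfloor>" for n
  define f where "f n z = \<theta> z + (\<eta> z / of_nat n - 2 * pi * \<i> * of_real (of_int (k n) / real n))" for n z
  have z0: "z0 \<in> ?D" using r by simp
  have Re: "Re (\<theta> z0) = 0"
    using unit \<theta>(2)[OF z0] by (simp add: norm_exp_eq_Re)
  have "(\<lambda>n. of_int \<lfloor>real n * x\<rfloor> / real n) \<longlonglongrightarrow> x" for x :: real
    by real_asymp
  from this[of "Im (\<theta> z0) / (2 * pi)"]
  have "(\<lambda>n. of_int (k n) / real n) \<longlonglongrightarrow> Im (\<theta> z0) / (2 * pi)"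
    by (simp add: k_def)
  then have "(\<lambda>n. 2 * pi * \<i> * of_real (of_int (k n) / real n)) \<longlonglongrightarrow> 2 * pi * \<i> * of_real (Im (\<theta> z0) / (2 * pi))"
    by (rule tendsto_mult_left[OF tendsto_of_real])
  also have "2 * pi * \<i> * of_real (Im (\<theta> z0) / (2 * pi)) = \<theta> z0"
    using Re by (simp add: complex_eq_iff)
  finally have lim_k: "(\<lambda>n. 2 * pi * \<i> * of_real (of_int (k n) / real n)) \<longlonglongrightarrow> \<theta> z0" .
  have "\<forall>\<^sub>F n in sequentially. \<exists>z\<in>?D \<inter> ball z0 e. f n z = 0"
  proof (rule Hurwitz_eventually_zero)
    \<comment> \<open>Both quotients by \<open>n\<close> are 0 for \<open>n = 0\<close>, so
      \<open>f 0\<close> is just \<open>\<theta>\<close>.\<close>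
    show "f n holomorphic_on ?D" for n
    proof (cases "n = 0")
      case False
      then show ?thesis unfolding f_def by (intro holomorphic_intros \<theta> \<eta>) auto
    qed (use \<theta>(1) in \<open>simp add: f_def[abs_def]\<close>)
    show "(\<lambda>z. \<theta> z - \<theta> z0) holomorphic_on ?D"
      by (intro holomorphic_intros \<theta>)
    show "uniform_limit K f (\<lambda>z. \<theta> z - \<theta> z0) sequentially" if K: "compact K" "K \<subseteq> ?D" for K
    proof -
      have "compact (\<eta> ` K)"
        using K \<eta>(1) by (intro compact_continuous_image holomorphic_on_imp_continuous_on)
          (auto intro: holomorphic_on_subset)
      then obtain M where M: "\<And>z. z \<in> K \<Longrightarrow> norm (\<eta> z) \<le> M"
        by (meson bounded_iff compact_imp_bounded imageI)
      have "uniform_limit K (\<lambda>n z. \<eta> z / of_nat n) (\<lambda>z. 0) sequentially"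
      proof (rule uniform_limitI)
        fix \<epsilon> :: real assume "\<epsilon> > 0"
        have "(\<lambda>n. M / real n) \<longlonglongrightarrow> 0" by real_asymp
        then have "\<forall>\<^sub>F n in sequentially. M / real n < \<epsilon>"
          using \<open>\<epsilon> > 0\<close> by (rule order_tendstoD)
        then show "\<forall>\<^sub>F n in sequentially. \<forall>z\<in>K. dist (\<eta> z / of_nat n) 0 < \<epsilon>"
        proof eventually_elim
          case (elim n)
          show ?case
          proof
            fix z assume "z \<in> K"
            then have "norm (\<eta> z) / real n \<le> M / real n"
              by (intro divide_right_mono M) auto
            with elim show "dist (\<eta> z / of_nat n) 0 < \<epsilon>"
              by (simp add: norm_divide)
          qed
        qed
      qed
      moreover have "uniform_limit K (\<lambda>n z. 2 * pi * \<i> * of_real (of_int (k n) / real n)) (\<lambda>z. \<theta> z0) sequentially"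
        using tendstoD[OF lim_k] by (intro uniform_limitI) (auto elim: eventually_mono)
      ultimately have "uniform_limit K f (\<lambda>z. \<theta> z + (0 - \<theta> z0)) sequentially"
        unfolding f_def by (intro uniform_limit_add uniform_limit_minus uniform_limit_const)
      then show ?thesis by simp
    qed
    show "\<not> (\<lambda>z. \<theta> z - \<theta> z0) constant_on ?D"
    proof
      assume "(\<lambda>z. \<theta> z - \<theta> z0) constant_on ?D"
      then obtain w where "\<And>z. z \<in> ?D \<Longrightarrow> \<theta> z - \<theta> z0 = w"
        by (auto simp: constant_on_def)
      then have "\<And>z. z \<in> ?D \<Longrightarrow> q z = exp (w + \<theta> z0)"
        using \<theta>(2) by (metis diff_add_cancel)
      with nonconst show False by (auto simp: constant_on_def)
    qed
  qed (use z0 e in auto)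
  with eventually_gt_at_top[of 0] show ?thesis
  proof eventually_elim
    case (elim n)
    then obtain z where z: "z \<in> ?D \<inter> ball z0 e" "f n z = 0" by auto
    have "of_nat n * \<theta> z + \<eta> z = 2 * of_int (k n) * pi * \<i>"
      using z(2) elim(1) by (simp add: f_def field_simps)
    moreover have "q z ^ n * h z = exp (of_nat n * \<theta> z + \<eta> z)"
      using z(1) \<theta>(2) \<eta>(2) by (simp add: exp_add exp_of_nat_mult)
    ultimately have "q z ^ n * h z = 1"
      by (simp add: exp_eq_1)
    with z(1) show ?case by blast
  qed
qed

section \<open>Limits of zeros of a general sequence of functions\<close>

text \<open>This form needs no choice of a sequence and fits the conclusions drawn from Hurwitz'
  theorem. For the converse direction, \<open>z n\<close> is a zero whose distance to
  \<open>x\<close> exceeds the infimum by less than \<open>1 / n\<close>; assumption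
  \<open>ex\<close> supplies zeros also for the small \<open>n\<close>, about which the criterion
  says nothing.\<close>

lemma limits_of_zeros_iff:
  assumes ex: "\<And>n. n \<ge> 1 \<Longrightarrow> \<exists>z. f n z = 0"
  shows "x \<in> limits_of_zeros f \<longleftrightarrow> (\<forall>e>0. \<forall>\<^sub>F n in sequentially. \<exists>z\<in>ball x e. f n z = 0)"
proof
  assume "x \<in> limits_of_zeros f"
  then obtain z where z: "\<And>n. n \<ge> 1 \<Longrightarrow> f n (z n) = 0" "z \<longlonglongrightarrow> x"
    by (auto simp: limits_of_zeros_def)
  show "\<forall>e>0. \<forall>\<^sub>F n in sequentially. \<exists>z\<in>ball x e. f n z = 0"
  proof (intro allI impI)
    fix e :: real assume "e > 0"
    with z(2) have "\<forall>\<^sub>F n in sequentially. dist (z n) x < e" by (rule tendstoD)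
    with eventually_ge_at_top[of 1] show "\<forall>\<^sub>F n in sequentially. \<exists>z\<in>ball x e. f n z = 0"
      by eventually_elim (use z(1) in \<open>auto simp: dist_commute intro!: bexI[of _ "z _"]\<close>)
  qed
next
  assume near: "\<forall>e>0. \<forall>\<^sub>F n in sequentially. \<exists>z\<in>ball x e. f n z = 0"
  let ?Z = "\<lambda>n. {z. f n z = 0}"
  have "\<exists>z. n \<ge> 1 \<longrightarrow> f n z = 0 \<and> dist x z < infdist x (?Z n) + 1 / real n" for n
  proof (cases "n \<ge> 1")
    case True
    then have "?Z n \<noteq> {}" using ex by auto
    moreover have "infdist x (?Z n) < infdist x (?Z n) + 1 / real n" using True by simp
    ultimately obtain z where "z \<in> ?Z n" "dist x z < infdist x (?Z n) + 1 / real n"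
      unfolding infdist_notempty[OF \<open>?Z n \<noteq> {}\<close>]
      by (subst (asm) cINF_less_iff) (auto intro: bdd_belowI2[of _ 0])
    then show ?thesis by auto
  qed auto
  then obtain z where z: "\<And>n. n \<ge> 1 \<Longrightarrow> f n (z n) = 0"
      "\<And>n. n \<ge> 1 \<Longrightarrow> dist x (z n) < infdist x (?Z n) + 1 / real n"
    by metis
  have "z \<longlonglongrightarrow> x"
  proof (rule tendstoI)
    fix e :: real assume "e > 0"
    have "(\<lambda>n. 1 / real n) \<longlonglongrightarrow> 0" by real_asymp
    then have "\<forall>\<^sub>F n in sequentially. 1 / real n < e / 2"
      using \<open>e > 0\<close> by (intro order_tendstoD) auto
    moreover have "\<forall>\<^sub>F n in sequentially. \<exists>z\<in>ball x (e / 2). f n z = 0"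
      using near \<open>e > 0\<close> by simp
    ultimately show "\<forall>\<^sub>F n in sequentially. dist (z n) x < e"
      using eventually_ge_at_top[of 1]
    proof eventually_elim
      case (elim n)
      then obtain w where "f n w = 0" "dist x w < e / 2" by auto
      then have "infdist x (?Z n) < e / 2"
        using infdist_le[of w "?Z n" x] by simp
      with elim z(2)[of n] show ?case by (simp add: dist_commute)
    qed
  qed
  with z(1) show "x \<in> limits_of_zeros f" by (auto simp: limits_of_zeros_def)
qed

text \<open>The neighbourhood criterion at a nearby limit \<open>y\<close> passes to
  \<open>x\<close> by the triangle inequality. Thanks to closedness, an accumulation point of limits
  of zeros is itself a limit of zeros.\<close>

lemma closed_limits_of_zeros:
  assumes ex: "\<And>n. n \<ge> 1 \<Longrightarrow> \<exists>z. f n z = 0"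
  shows "closed (limits_of_zeros f)"
  unfolding closed_limpt
proof (intro allI impI)
  fix x assume x: "x islimpt limits_of_zeros f"
  have "\<forall>\<^sub>F n in sequentially. \<exists>z\<in>ball x e. f n z = 0" if "e > 0" for e
  proof -
    obtain y where y: "y \<in> limits_of_zeros f" "dist y x < e / 2"
      using x \<open>e > 0\<close> by (meson half_gt_zero islimpt_approachable)
    have "\<forall>\<^sub>F n in sequentially. \<exists>z\<in>ball y (e / 2). f n z = 0"
      using y(1) \<open>e > 0\<close> limits_of_zeros_iff[of f y, OF ex] by simp
    moreover have "ball y (e / 2) \<subseteq> ball x e"
      using y(2) by (intro subsetI) (metric)
    ultimately show ?thesis
      by (auto elim!: eventually_mono)
  qed
  then show "x \<in> limits_of_zeros f"
    by (simp add: limits_of_zeros_iff[of f x, OF ex])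
qed

section \<open>The polynomials \<open>W\<close> and their zeros\<close>

text \<open>As \<open>a \<noteq> 0\<close>, multiplication by \<open>a z + b\<close> raises the
  degree by exactly one, while the other summand of the recurrence has smaller degree and cannot
  cancel the leading term.\<close>

lemma W_eq_poly:
  assumes "a > 0"
  shows "\<exists>p. W a b c d n = poly p \<and> degree p = n"
proof (induction n rule: less_induct)
  case (less n)
  consider "n = 0" | "n = 1" | m where "n = Suc (Suc m)"
    by (metis One_nat_def not0_implies_Suc)
  then show ?case
  proof cases
    case 1
    then show ?thesis by (intro exI[of _ 1]) auto
  next
    case 2
    then show ?thesis by (intro exI[of _ "[:0, 1:]"]) auto
  next
    case (3 m)
    obtain p where p: "W a b c d m = poly p" "degree p = m"
      using less.IH[of m] 3 by auto
    obtain q where q: "W a b c d (Suc m) = poly q" "degree q = Suc m"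
      using less.IH[of "Suc m"] 3 by auto
    have "q \<noteq> 0" using q(2) by auto
    then have "degree ([:of_real b, of_real a:] * q) = Suc (Suc m)"
      using q(2) assms by (subst degree_mult_eq) auto
    moreover have "degree ([:of_real d, of_real c:] * p) < Suc (Suc m)"
      using degree_mult_le[of "[:of_real d, of_real c:]" p] p(2)
      by (auto split: if_splits)
    ultimately have "degree ([:of_real b, of_real a:] * q + [:of_real d, of_real c:] * p) = n"
      by (subst degree_add_eq_left) (auto simp: 3)
    moreover have "W a b c d n = poly ([:of_real b, of_real a:] * q + [:of_real d, of_real c:] * p)"
      by (rule ext) (simp add: 3 p q algebra_simps)
    ultimately show ?thesis by blast
  qed
qed

lemma W_has_zero:
  assumes "a > 0" "n \<ge> 1"
  shows "\<exists>z. W a b c d n z = 0"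
proof -
  obtain p where p: "W a b c d n = poly p" "degree p = n"
    using W_eq_poly[OF assms(1)] by blast
  then show ?thesis
    using Fundamental_Theorem_Algebra.fundamental_theorem_of_algebra[of p] assms(2)
    by (auto simp: constant_degree)
qed

section \<open>Characteristic roots and Binet's formula\<close>

locale W_sequence =
  fixes a b c d :: real
  assumes pos: "a > 0" "b > 0" "c > 0" "d > 0"
begin

definition A :: "complex \<Rightarrow> complex" where "A z = of_real a * z + of_real b"
definition B :: "complex \<Rightarrow> complex" where "B z = of_real c * z + of_real d"
text \<open>The characteristic polynomial \<open>t^2 - A z * t - B z\<close> at
  \<open>t = z\<close>. It is the product of \<open>z - l1\<close> and \<open>z - l2\<close>, so off
  its zeros neither coefficient in Binet's formula vanishes.\<close>

definition G :: "complex \<Rightarrow> complex" where "G z = z\<^sup>2 - A z * z - B z"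

abbreviation limits :: "complex set" where "limits \<equiv> limits_of_zeros (W a b c d)"

lemma holomorphic_AB [holomorphic_intros]: "A holomorphic_on S" "B holomorphic_on S"
  unfolding A_def[abs_def] B_def[abs_def] by (intro holomorphic_intros)+

lemma holomorphic_G: "G holomorphic_on S"
  unfolding G_def[abs_def] by (intro holomorphic_intros)

lemma limits_iff: "x \<in> limits \<longleftrightarrow> (\<forall>e>0. \<forall>\<^sub>F n in sequentially. \<exists>z\<in>ball x e. W a b c d n z = 0)"
  using W_has_zero[OF pos(1)] by (rule limits_of_zeros_iff)

text \<open>The constant coefficient \<open>- d\<close> is non-zero, which covers also
  \<open>a = 1\<close>, where the quadratic term disappears.\<close>

lemma finite_zeros_G: "finite {z. G z = 0}"
proof -
  have "G z = poly [:- of_real d, - of_real (b + c), of_real (1 - a):] z" for z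
    by (simp add: G_def A_def B_def power2_eq_square algebra_simps)
  then show ?thesis
    using pos poly_roots_finite[of "[:- complex_of_real d, - of_real (b + c), of_real (1 - a):]"]
    by simp
qed

text \<open>The leading coefficient \<open>k * a^2\<close> is non-zero, so the polynomial has
  finitely many roots, whereas a ball is uncountable. This excludes constancy of the quotient of the
  characteristic roots and of \<open>A^2 / B\<close>.\<close>

lemma A_square_not_proportional_B:
  assumes "k \<noteq> 0" "r > 0"
  shows "\<exists>z\<in>ball x r. k * (A z)\<^sup>2 + m * B z \<noteq> 0"
proof (rule ccontr)
  define p where "p = [:k * of_real b ^ 2 + m * of_real d, 2 * k * of_real (a * b) + m * of_real c, k * of_real a ^ 2:]"
  have p: "k * (A z)\<^sup>2 + m * B z = poly p z" for z
    by (simp add: p_def A_def B_def power2_eq_square algebra_simps)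
  assume "\<not> ?thesis"
  then have "ball x r \<subseteq> {z. poly p z = 0}"
    by (auto simp: p)
  moreover have "p \<noteq> 0"
    using pos assms by (simp add: p_def)
  ultimately show False
    using finite_subset poly_roots_finite uncountable_infinite[OF uncountable_ball[OF assms(2)]]
    by blast
qed

lemma G_factor_roots:
  assumes "l1 + l2 = A z" "l1 * l2 = - B z"
  shows "G z = (z - l1) * (z - l2)"
proof -
  have B: "B z = - (l1 * l2)" using assms(2) by simp
  show ?thesis
    unfolding G_def B assms(1)[symmetric] by (simp add: power2_eq_square algebra_simps)
qed

lemma W_Binet:
  assumes "l1 + l2 = A z" "l1 * l2 = - B z"
  shows "(l1 - l2) * W a b c d n z = (z - l2) * l1 ^ n - (z - l1) * l2 ^ n"
proof -
  have B: "B z = - (l1 * l2)" using assms(2) by simp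
  \<comment> \<open>The recurrence has order two, so the induction carries two consecutive
    indices.\<close>
  have "(l1 - l2) * W a b c d n z = (z - l2) * l1 ^ n - (z - l1) * l2 ^ n \<and>
    (l1 - l2) * W a b c d (Suc n) z = (z - l2) * l1 ^ Suc n - (z - l1) * l2 ^ Suc n"
  proof (induction n)
    case 0
    show ?case by (simp add: algebra_simps)
  next
    case (Suc n)
    have "(l1 - l2) * W a b c d (Suc (Suc n)) z =
        (l1 + l2) * ((l1 - l2) * W a b c d (Suc n) z) - l1 * l2 * ((l1 - l2) * W a b c d n z)"
      using assms(1) B by (simp add: A_def B_def algebra_simps)
    also have "\<dots> = (z - l2) * l1 ^ Suc (Suc n) - (z - l1) * l2 ^ Suc (Suc n)"
      by (simp only: Suc.IH) (simp add: algebra_simps)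
    finally show ?case using Suc.IH by blast
  qed
  then show ?thesis ..
qed

text \<open>The discriminant \<open>D\<close> divided by \<open>s^2\<close> is 1 at
  \<open>x\<close>, hence stays in the right half-plane near \<open>x\<close>, away from the branch
  cut of \<open>csqrt\<close>. The factor \<open>s = l1 - l2\<close> gives
  \<open>\<sigma> x = s\<close>, which fixes the root that each branch follows.\<close>

lemma local_branches:
  assumes l: "l1 + l2 = A x" "l1 * l2 = - B x" "l1 \<noteq> l2" and U: "open U" "x \<in> U"
  obtains r L1 L2 where "r > 0" "ball x r \<subseteq> U" "L1 holomorphic_on ball x r" "L2 holomorphic_on ball x r"
    "L1 x = l1" "L2 x = l2"
    "\<And>z. z \<in> ball x r \<Longrightarrow> L1 z + L2 z = A z" "\<And>z. z \<in> ball x r \<Longrightarrow> L1 z * L2 z = - B z"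
    "\<And>z. z \<in> ball x r \<Longrightarrow> L1 z \<noteq> L2 z"
proof -
  define s where "s = l1 - l2"
  define D where "D z = (A z)\<^sup>2 + 4 * B z" for z
  define \<sigma> where "\<sigma> z = s * csqrt (D z / s\<^sup>2)" for z
  have s: "s \<noteq> 0" using l by (simp add: s_def)
  have B: "B x = - (l1 * l2)" using l(2) by simp
  have Dx: "D x = s\<^sup>2"
    unfolding D_def s_def B l(1)[symmetric] by (simp add: power2_eq_square algebra_simps)
  have hol: "(\<lambda>z. D z / s\<^sup>2) holomorphic_on S" for S
    unfolding D_def by (intro holomorphic_intros) (use s in auto)
  have "open {z. 0 < Re (D z / s\<^sup>2)}"
    using holomorphic_on_imp_continuous_on[OF hol]
    by (intro open_Collect_less continuous_on_const continuous_on_Re)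
  then obtain r where r: "r > 0" "ball x r \<subseteq> U \<inter> {z. 0 < Re (D z / s\<^sup>2)}"
    using U s Dx
      by (metis (no_types, lifting) Int_iff divide_self mem_Collect_eq one_complex.sel(1) open_Int open_contains_ball power_not_zero zero_less_one)
  have "\<sigma> holomorphic_on ball x r"
    unfolding \<sigma>_def using r(2)
    by (intro holomorphic_intros holomorphic_on_csqrt' hol) (auto simp: complex_nonpos_Reals_iff)
  moreover have sq: "\<sigma> z * \<sigma> z = D z" for z
  proof -
    have "\<sigma> z * \<sigma> z = s\<^sup>2 * (csqrt (D z / s\<^sup>2))\<^sup>2"
      by (simp add: \<sigma>_def power2_eq_square)
    then show ?thesis using s by simp
  qed
  moreover have "\<sigma> z \<noteq> 0" if "z \<in> ball x r" for z
  proof -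
    have "0 < Re (D z / s\<^sup>2)" using r(2) that by blast
    then show ?thesis using sq[of z] by auto
  qed
  moreover have "\<sigma> x = s" using s Dx by (simp add: \<sigma>_def)
  moreover have "(A z + \<sigma> z) / 2 * ((A z - \<sigma> z) / 2) = - B z" for z
    using sq[of z] by (simp add: D_def field_simps power2_eq_square)
  ultimately show ?thesis
    using r l(1)
    by (intro that[of r "\<lambda>z. (A z + \<sigma> z) / 2" "\<lambda>z. (A z - \<sigma> z) / 2"])
      (auto intro!: holomorphic_intros simp: s_def field_simps)
qed

section \<open>Roots of equal modulus and a dominant root\<close>

text \<open>Near \<open>x\<close> Binet's formula turns \<open>W a b c d n z = 0\<close> into
  \<open>(L1 z / L2 z) ^ n * ((z - L2 z) / (z - L1 z)) = 1\<close>, an equation of the type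
  \<open>q ^ n * h = 1\<close> with \<open>q x\<close> on the unit circle.\<close>

lemma equimodular_limit:
  assumes l: "l1 + l2 = A x" "l1 * l2 = - B x" "l1 \<noteq> l2" "norm l1 = norm l2"
    and nz: "B x \<noteq> 0" "G x \<noteq> 0"
  shows "x \<in> limits"
proof -
  have U: "open ({z. B z \<noteq> 0} \<inter> {z. G z \<noteq> 0})"
    using holomorphic_on_imp_continuous_on[OF holomorphic_AB(2)]
      holomorphic_on_imp_continuous_on[OF holomorphic_G]
    by (intro open_Int open_Collect_neq continuous_on_const)
  obtain r L1 L2 where r: "r > 0" "ball x r \<subseteq> {z. B z \<noteq> 0} \<inter> {z. G z \<noteq> 0}"
      and hol: "L1 holomorphic_on ball x r" "L2 holomorphic_on ball x r"
      and Lx: "L1 x = l1" "L2 x = l2"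
      and sum: "\<And>z. z \<in> ball x r \<Longrightarrow> L1 z + L2 z = A z"
      and prod: "\<And>z. z \<in> ball x r \<Longrightarrow> L1 z * L2 z = - B z"
      and ne: "\<And>z. z \<in> ball x r \<Longrightarrow> L1 z \<noteq> L2 z"
    using local_branches[OF l(1-3) U] nz by blast
  have L_nz: "L1 z \<noteq> 0" "L2 z \<noteq> 0" if "z \<in> ball x r" for z
    using r(2) that prod[OF that] by auto
  have z_ne: "z - L1 z \<noteq> 0" "z - L2 z \<noteq> 0" if "z \<in> ball x r" for z
  proof -
    have "G z = (z - L1 z) * (z - L2 z)"
      using sum[OF that] prod[OF that] by (rule G_factor_roots)
    moreover have "G z \<noteq> 0" using r(2) that by blast
    ultimately show "z - L1 z \<noteq> 0" "z - L2 z \<noteq> 0" by auto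
  qed
  show ?thesis
    unfolding limits_iff
  proof (intro allI impI)
    fix e :: real assume "e > 0"
    have "\<forall>\<^sub>F n in sequentially. \<exists>z\<in>ball x r \<inter> ball x e.
        (L1 z / L2 z) ^ n * ((z - L2 z) / (z - L1 z)) = 1"
    proof (rule eventually_power_mult_eq_1)
      show "\<not> (\<lambda>z. L1 z / L2 z) constant_on ball x r"
      proof
        assume "(\<lambda>z. L1 z / L2 z) constant_on ball x r"
        then obtain k where k: "\<And>z. z \<in> ball x r \<Longrightarrow> L1 z / L2 z = k"
          by (auto simp: constant_on_def)
        have "k \<noteq> 0" using k[of x] L_nz[of x] r(1) by auto
        \<comment> \<open>If \<open>L1 = k * L2\<close>, then \<open>A = (1 + k) * L2\<close> and
          \<open>B = - k * L2^2\<close>; eliminating \<open>L2\<close> gives the relation.\<close>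
        moreover have "k * (A z)\<^sup>2 + (1 + k)\<^sup>2 * B z = 0" if "z \<in> ball x r" for z
        proof -
          have L1: "L1 z = k * L2 z" using k[OF that] L_nz[OF that] by (simp add: field_simps)
          have B: "B z = - (L1 z * L2 z)" using prod[OF that] by simp
          show ?thesis
            unfolding B sum[OF that, symmetric] L1 by (simp add: power2_eq_square algebra_simps)
        qed
        ultimately show False
          using A_square_not_proportional_B[of k r x "(1 + k)\<^sup>2"] r(1) by blast
      qed
      show "norm (L1 x / L2 x) = 1"
        using l(4) L_nz[of x] r(1) by (simp add: Lx norm_divide)
    qed (use r(1) \<open>e > 0\<close> hol L_nz z_ne in \<open>auto intro!: holomorphic_intros\<close>)
    then show "\<forall>\<^sub>F n in sequentially. \<exists>z\<in>ball x e. W a b c d n z = 0"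
    proof eventually_elim
      case (elim n)
      then obtain z where z: "z \<in> ball x r" "z \<in> ball x e"
          "(L1 z / L2 z) ^ n * ((z - L2 z) / (z - L1 z)) = 1" by blast
      have "(z - L2 z) * L1 z ^ n - (z - L1 z) * L2 z ^ n = 0"
        using z(3) L_nz[OF z(1)] z_ne[OF z(1)] by (simp add: field_simps power_divide)
      then have "W a b c d n z = 0"
        using W_Binet[OF sum prod, OF z(1) z(1), of n] ne[OF z(1)] by simp
      with z(2) show ?case by blast
    qed
  qed
qed

text \<open>Dividing Binet's formula by \<open>L1 z ^ n\<close> leaves \<open>z - L2 z\<close> minus
  \<open>(z - L1 z) * (L2 z / L1 z) ^ n\<close>, and the last term decays geometrically, uniformly
  near \<open>x\<close>.\<close>

lemma dominated_normal_form:
  assumes l: "l1 + l2 = A x" "l1 * l2 = - B x" "norm l2 < norm l1"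
  obtains r f g where "r > 0" "\<And>n. f n holomorphic_on ball x r" "g holomorphic_on ball x r"
    "uniform_limit (ball x r) f g sequentially" "g x = x - l2"
    "\<And>n z. z \<in> ball x r \<Longrightarrow> W a b c d n z = 0 \<longleftrightarrow> f n z = 0"
    "\<And>z. z \<in> ball x r \<Longrightarrow> g z = 0 \<Longrightarrow> G z = 0"
proof -
  have "l1 \<noteq> l2" using l(3) by auto
  then obtain r0 L1 L2 where r0: "r0 > 0"
      and hol: "L1 holomorphic_on ball x r0" "L2 holomorphic_on ball x r0"
      and Lx: "L1 x = l1" "L2 x = l2"
      and sum: "\<And>z. z \<in> ball x r0 \<Longrightarrow> L1 z + L2 z = A z"
      and prod: "\<And>z. z \<in> ball x r0 \<Longrightarrow> L1 z * L2 z = - B z"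
      and ne: "\<And>z. z \<in> ball x r0 \<Longrightarrow> L1 z \<noteq> L2 z"
    using local_branches[OF l(1,2) _ open_UNIV UNIV_I] by metis
  \<comment> \<open>A ratio strictly between that of the moduli at \<open>x\<close> and 1 leaves
    room for \<open>norm (L2 z) < \<kappa> * norm (L1 z)\<close> to persist on a
    neighbourhood.\<close>
  obtain \<kappa> where \<kappa>: "norm l2 / norm l1 < \<kappa>" "\<kappa> < 1"
    using dense[of "norm l2 / norm l1" 1] l(3) by (auto simp: divide_less_eq_1)
  have \<kappa>0: "\<kappa> \<ge> 0" using \<kappa>(1) by (meson divide_nonneg_nonneg less_imp_le norm_ge_zero order_trans)
  define M where "M = norm (x - l1) + 1"
  have cont: "continuous_on (ball x r0) L1" "continuous_on (ball x r0) L2"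
    using hol by (auto intro: holomorphic_on_imp_continuous_on)
  have "l1 \<noteq> 0" using l(3) by auto
  have "open (ball x r0 \<inter> (\<lambda>z. \<kappa> * norm (L1 z) - norm (L2 z)) -` {0<..})"
    using cont by (intro continuous_open_preimage continuous_intros) auto
  moreover have "open (ball x r0 \<inter> (\<lambda>z. norm (z - L1 z)) -` {..<M})"
    using cont by (intro continuous_open_preimage continuous_intros) auto
  ultimately have "open (ball x r0 \<inter> (\<lambda>z. \<kappa> * norm (L1 z) - norm (L2 z)) -` {0<..} \<inter>
      (ball x r0 \<inter> (\<lambda>z. norm (z - L1 z)) -` {..<M}))"
    by (rule open_Int)
  moreover have "x \<in> ball x r0 \<inter> (\<lambda>z. \<kappa> * norm (L1 z) - norm (L2 z)) -` {0<..} \<inter>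
      (ball x r0 \<inter> (\<lambda>z. norm (z - L1 z)) -` {..<M})"
    using r0 \<kappa>(1) \<open>l1 \<noteq> 0\<close> by (simp add: Lx M_def field_simps)
  ultimately obtain r where r: "r > 0"
    and ball: "ball x r \<subseteq> ball x r0 \<inter> (\<lambda>z. \<kappa> * norm (L1 z) - norm (L2 z)) -` {0<..} \<inter>
      (ball x r0 \<inter> (\<lambda>z. norm (z - L1 z)) -` {..<M})"
    by (metis open_contains_ball)
  have in_ball: "z \<in> ball x r0" "norm (L2 z) < \<kappa> * norm (L1 z)" "norm (z - L1 z) < M"
    if "z \<in> ball x r" for z
    using subsetD[OF ball that] by simp_all
  have L1_nz: "L1 z \<noteq> 0" if "z \<in> ball x r" for z
    using in_ball(2)[OF that] by auto
  have hol': "L1 holomorphic_on ball x r" "L2 holomorphic_on ball x r"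
    using hol in_ball(1) by (auto intro: holomorphic_on_subset)
  define f where "f n z = z - L2 z - (z - L1 z) * (L2 z / L1 z) ^ n" for n z
  define g where "g z = z - L2 z" for z
  have "uniform_limit (ball x r) f g sequentially"
  proof (rule uniform_limitI)
    fix \<epsilon> :: real assume "\<epsilon> > 0"
    have "(\<lambda>n. M * \<kappa> ^ n) \<longlonglongrightarrow> M * 0"
      using \<kappa> \<kappa>0 by (intro tendsto_intros LIMSEQ_realpow_zero)
    then have "\<forall>\<^sub>F n in sequentially. M * \<kappa> ^ n < \<epsilon>"
      using \<open>\<epsilon> > 0\<close> by (intro order_tendstoD) auto
    then show "\<forall>\<^sub>F n in sequentially. \<forall>z\<in>ball x r. dist (f n z) (g z) < \<epsilon>"
    proof eventually_elim
      case (elim n)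
      show ?case
      proof
        fix z assume z: "z \<in> ball x r"
        have "norm (L2 z / L1 z) \<le> \<kappa>"
          using in_ball(2)[OF z] L1_nz[OF z] by (simp add: norm_divide field_simps)
        then have "norm (z - L1 z) * norm (L2 z / L1 z) ^ n \<le> M * \<kappa> ^ n"
          using in_ball(3)[OF z] by (intro mult_mono power_mono) (auto simp: M_def)
        then show "dist (f n z) (g z) < \<epsilon>"
          using elim by (simp add: f_def g_def dist_norm norm_mult norm_power)
      qed
    qed
  qed
  moreover have "W a b c d n z = 0 \<longleftrightarrow> f n z = 0" if z: "z \<in> ball x r" for n z
  proof -
    have "L1 z ^ n * (L2 z / L1 z) ^ n = L2 z ^ n"
      using L1_nz[OF z] by (simp flip: power_mult_distrib)
    moreover have "L1 z ^ n * f n z = (z - L2 z) * L1 z ^ n - (z - L1 z) * (L1 z ^ n * (L2 z / L1 z) ^ n)"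
      by (simp add: f_def algebra_simps)
    ultimately have "(L1 z - L2 z) * W a b c d n z = L1 z ^ n * f n z"
      using W_Binet[OF sum prod, OF in_ball(1) in_ball(1), OF z z, of n] by simp
    then show ?thesis
      using ne[OF in_ball(1)[OF z]] L1_nz[OF z] by (metis eq_iff_diff_eq_0 mult_eq_0_iff power_not_zero)
  qed
  moreover have "G z = 0" if z: "z \<in> ball x r" "g z = 0" for z
  proof -
    have "G z = (z - L1 z) * (z - L2 z)"
      using sum[OF in_ball(1)[OF z(1)]] prod[OF in_ball(1)[OF z(1)]] by (rule G_factor_roots)
    with z(2) show ?thesis by (simp add: g_def)
  qed
  moreover have "f n holomorphic_on ball x r" for n
    unfolding f_def using L1_nz hol' by (auto intro!: holomorphic_intros)
  moreover have "g holomorphic_on ball x r"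
    unfolding g_def using hol' by (intro holomorphic_intros)
  ultimately show ?thesis
    using r by (intro that[of r f g]) (auto simp: g_def Lx)
qed

text \<open>If \<open>x = l2\<close>, the limit function \<open>g\<close> vanishes at
  \<open>x\<close> and is not constant, since its zeros lie in the finite zero set of
  \<open>G\<close>; Hurwitz' theorem then yields zeros of \<open>W\<close> near \<open>x\<close>.
  Conversely, zeros converging to \<open>x\<close> force \<open>g\<close> to tend to 0 along them,
  and continuity gives \<open>g x = 0\<close>.\<close>

lemma limit_iff_dominated:
  assumes l: "l1 + l2 = A x" "l1 * l2 = - B x" "norm l2 < norm l1"
  shows "x \<in> limits \<longleftrightarrow> x = l2"
proof -
  obtain r f g where r: "r > 0" and hol: "\<And>n. f n holomorphic_on ball x r" "g holomorphic_on ball x r"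
    and lim: "uniform_limit (ball x r) f g sequentially" and gx: "g x = x - l2"
    and W: "\<And>n z. z \<in> ball x r \<Longrightarrow> W a b c d n z = 0 \<longleftrightarrow> f n z = 0"
    and G: "\<And>z. z \<in> ball x r \<Longrightarrow> g z = 0 \<Longrightarrow> G z = 0"
    using dominated_normal_form[OF l] by metis
  show ?thesis
  proof
    assume "x = l2"
    have nonconst: "\<not> g constant_on ball x r"
    proof
      assume "g constant_on ball x r"
      then have "ball x r \<subseteq> {z. G z = 0}"
        using G gx r \<open>x = l2\<close> unfolding constant_on_def
        by (metis (mono_tags, lifting) centre_in_ball diff_self mem_Collect_eq subsetI)
      then show False
        using finite_subset[OF _ finite_zeros_G] uncountable_infinite[OF uncountable_ball[OF r]]
        by blast
    qed
    show "x \<in> limits"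
      unfolding limits_iff
    proof (intro allI impI)
      fix e :: real assume "e > 0"
      have "\<forall>\<^sub>F n in sequentially. \<exists>z\<in>ball x r \<inter> ball x e. f n z = 0"
        by (rule Hurwitz_eventually_zero[OF _ _ hol _ nonconst])
          (use uniform_limit_on_subset[OF lim] r gx \<open>x = l2\<close> \<open>e > 0\<close> in auto)
      then show "\<forall>\<^sub>F n in sequentially. \<exists>z\<in>ball x e. W a b c d n z = 0"
        by eventually_elim (use W in blast)
    qed
  next
    assume "x \<in> limits"
    then obtain z where z: "\<And>n. n \<ge> 1 \<Longrightarrow> W a b c d n (z n) = 0" "z \<longlonglongrightarrow> x"
      by (auto simp: limits_of_zeros_def)
    have in_ball: "\<forall>\<^sub>F n in sequentially. z n \<in> ball x r"
      using tendstoD[OF z(2) r] by (simp add: dist_commute)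
    have "isCont g x"
      using hol(2) r by (meson centre_in_ball continuous_on_eq_continuous_at
          holomorphic_on_imp_continuous_on open_ball)
    then have "(\<lambda>n. g (z n)) \<longlonglongrightarrow> x - l2"
      using z(2) gx isCont_tendsto_compose by metis
    moreover have "(\<lambda>n. g (z n)) \<longlonglongrightarrow> 0"
    proof (rule tendstoI)
      fix e :: real assume "e > 0"
      from uniform_limitD[OF lim this] in_ball eventually_ge_at_top[of 1]
      show "\<forall>\<^sub>F n in sequentially. dist (g (z n)) 0 < e"
      proof eventually_elim
        case (elim n)
        then have "f n (z n) = 0" using W z(1) by blast
        with elim show ?case by (metis dist_commute)
      qed
    qed
    ultimately show "x = l2"
      using LIMSEQ_unique by fastforce
  qed
qed

text \<open>Writing \<open>t = 4 * (cos \<phi>)^2\<close>, the characteristic roots are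
  \<open>\<rho> * cis \<phi>\<close> and \<open>\<rho> * cis (- \<phi>)\<close> with
  \<open>\<rho>^2 = - B x\<close>. They have equal modulus, and they are distinct because
  \<open>t < 4\<close> makes \<open>sin \<phi>\<close> non-zero.\<close>

lemma circle_limit:
  assumes t: "0 < t" "t < 4" "(A x)\<^sup>2 + of_real t * B x = 0" and nz: "B x \<noteq> 0" "G x \<noteq> 0"
  shows "x \<in> limits"
proof -
  define \<phi> where "\<phi> = arccos (sqrt t / 2)"
  have "sqrt t < 2" using t real_sqrt_less_mono[of t 4] by simp
  moreover have "- 2 < sqrt t" using t real_sqrt_ge_zero[of t] by linarith
  ultimately have \<phi>: "cos \<phi> = sqrt t / 2" "0 < \<phi>" "\<phi> < pi"
    using arccos_lt_bounded[of "sqrt t / 2"] by (simp_all add: \<phi>_def)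
  have cos2: "4 * (cos \<phi>)\<^sup>2 = t" using t by (simp add: \<phi> power_divide)
  have "(A x)\<^sup>2 = (2 * of_real (cos \<phi>) * csqrt (- B x))\<^sup>2"
  proof -
    have "(2 * of_real (cos \<phi>) * csqrt (- B x))\<^sup>2 = of_real (4 * (cos \<phi>)\<^sup>2) * (- B x)"
      by (simp add: power_mult_distrib)
    also have "\<dots> = - (of_real t * B x)" unfolding cos2 by simp
    also have "\<dots> = (A x)\<^sup>2" using t(3) by (metis eq_neg_iff_add_eq_0)
    finally show ?thesis ..
  qed
  then have "A x = 2 * of_real (cos \<phi>) * csqrt (- B x) \<or> A x = - (2 * of_real (cos \<phi>) * csqrt (- B x))"
    by (simp only: power2_eq_iff)
  \<comment> \<open>The sign of the square root \<open>\<rho>\<close> is chosen to match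
    \<open>A x\<close>.\<close>
  then obtain \<rho> where \<rho>: "A x = 2 * of_real (cos \<phi>) * \<rho>" "\<rho>\<^sup>2 = - B x"
    by (metis mult_minus_right power2_csqrt power2_minus)
  show ?thesis
  proof (rule equimodular_limit)
    show "\<rho> * cis \<phi> + \<rho> * cis (- \<phi>) = A x"
      by (simp add: \<rho> complex_eq_iff algebra_simps)
    have "\<rho> * cis \<phi> * (\<rho> * cis (- \<phi>)) = \<rho>\<^sup>2 * (cis \<phi> * cis (- \<phi>))"
      by (simp add: power2_eq_square)
    also have "\<dots> = - B x" by (simp add: cis_mult \<rho>)
    finally show "\<rho> * cis \<phi> * (\<rho> * cis (- \<phi>)) = - B x" .
    have "\<rho> \<noteq> 0" using \<rho> nz by auto
    moreover have "cis \<phi> \<noteq> cis (- \<phi>)"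
      using sin_gt_zero[OF \<phi>(2,3)] by (auto simp: complex_eq_iff)
    ultimately show "\<rho> * cis \<phi> \<noteq> \<rho> * cis (- \<phi>)" by simp
  qed (use nz in \<open>simp_all add: norm_mult\<close>)
qed

section \<open>Accumulation points of limits of zeros\<close>

lemma closed_limits: "closed limits"
  using W_has_zero[OF pos(1)] by (rule closed_limits_of_zeros)

lemma nonisolatedI:
  assumes "x islimpt limits"
  shows "nonisolated_limit_of_zeros (W a b c d) x"
  using assms closed_limits by (auto simp: nonisolated_limit_of_zeros_def closed_limpt)

text \<open>The map \<open>F = - A^2 / B\<close> is holomorphic and non-constant near
  \<open>x\<close>, hence open, and \<open>F x = t\<close>. It therefore takes infinitely many real
  values in \<open>(0, 4)\<close> arbitrarily near \<open>x\<close>; the preimages outside the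
  finite zero set of \<open>G\<close> are limits by \<open>circle_limit\<close>.\<close>

lemma circle_islimpt:
  assumes t: "0 \<le> t" "t \<le> 4" "(A x)\<^sup>2 + of_real t * B x = 0" and nz: "B x \<noteq> 0"
  shows "x islimpt limits"
  unfolding islimpt_eq_infinite_ball
proof (intro allI impI)
  fix e :: real assume "e > 0"
  have "open ({z. B z \<noteq> 0} \<inter> ball x e)"
    using holomorphic_on_imp_continuous_on[OF holomorphic_AB(2)]
    by (intro open_Int open_Collect_neq continuous_on_const open_ball)
  then obtain r where r: "r > 0" "ball x r \<subseteq> {z. B z \<noteq> 0} \<inter> ball x e"
    using nz \<open>e > 0\<close> by (metis (mono_tags) Int_iff centre_in_ball mem_Collect_eq open_contains_ball)
  define F where "F z = - ((A z)\<^sup>2 / B z)" for z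
  have F: "F z = s \<longleftrightarrow> (A z)\<^sup>2 + s * B z = 0" if "z \<in> ball x r" for z s
  proof -
    have "B z \<noteq> 0" using r(2) that by blast
    then have "F z = s \<longleftrightarrow> (A z)\<^sup>2 = - (s * B z)"
      by (auto simp: F_def field_simps) (metis minus_minus)
    then show ?thesis by (simp add: eq_neg_iff_add_eq_0)
  qed
  have "F holomorphic_on ball x r"
    unfolding F_def[abs_def] using r(2) by (intro holomorphic_intros) auto
  moreover have "\<not> F constant_on ball x r"
  proof
    assume "F constant_on ball x r"
    then obtain s where "\<And>z. z \<in> ball x r \<Longrightarrow> F z = s" by (auto simp: constant_on_def)
    then show False
      using F A_square_not_proportional_B[of 1 r x s] r(1) by auto
  qed
  ultimately have "open (F ` ball x r)"
    by (intro open_mapping_thm[of F "ball x r"]) auto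
  moreover have "of_real t \<in> F ` ball x r"
    using F[of x "of_real t"] t(3) r(1) by (metis centre_in_ball image_eqI)
  ultimately obtain \<delta> where \<delta>: "\<delta> > 0" "ball (of_real t) \<delta> \<subseteq> F ` ball x r"
    by (metis open_contains_ball)
  \<comment> \<open>Here \<open>t\<close> may be 0 or 4; the interval around it, clipped to
    \<open>(0, 4)\<close>, is still non-empty.\<close>
  have "infinite {max 0 (t - \<delta>)<..<min 4 (t + \<delta>)}"
    using \<delta>(1) t by (intro infinite_Ioo) auto
  moreover have "complex_of_real ` {max 0 (t - \<delta>)<..<min 4 (t + \<delta>)} \<subseteq>
      F ` {z \<in> ball x r. \<exists>s. 0 < s \<and> s < 4 \<and> F z = of_real s}"
  proof safe
    fix s assume s: "s \<in> {max 0 (t - \<delta>)<..<min 4 (t + \<delta>)}"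
    then have "complex_of_real s \<in> ball (of_real t) \<delta>"
      by (auto simp: dist_real_def)
    then obtain z where "z \<in> ball x r" "F z = of_real s"
      using \<delta>(2) by (metis imageE subsetD)
    with s show "complex_of_real s \<in> F ` {z \<in> ball x r. \<exists>s. 0 < s \<and> s < 4 \<and> F z = of_real s}"
      by (intro image_eqI[of _ _ z]) auto
  qed
  ultimately have "infinite {z \<in> ball x r. \<exists>s. 0 < s \<and> s < 4 \<and> F z = of_real s}"
    by (metis (no_types, lifting) finite_imageD finite_imageI finite_subset inj_of_real inj_on_subset subset_UNIV)
  then have "infinite ({z \<in> ball x r. \<exists>s. 0 < s \<and> s < 4 \<and> F z = of_real s} - {z. G z = 0})"
    using finite_zeros_G by simp
  moreover have "{z \<in> ball x r. \<exists>s. 0 < s \<and> s < 4 \<and> F z = of_real s} - {z. G z = 0} \<subseteq> limits \<inter> ball x e"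
  proof safe
    fix z s assume z: "z \<in> ball x r" "G z \<noteq> 0" "0 < s" "s < 4" "F z = complex_of_real s"
    then show "z \<in> limits"
      using circle_limit[of s z] r(2) F[of z "of_real s"] by blast
    show "z \<in> ball x e" using z(1) r(2) by blast
  qed
  ultimately show "infinite (limits \<inter> ball x e)"
    using finite_subset by blast
qed

text \<open>When \<open>a * d = b * c\<close>, \<open>A\<close> and \<open>B\<close> vanish together
  at \<open>- b / a\<close>, so \<open>circle_islimpt\<close> does not apply there. But then
  \<open>B = (c / a) * A\<close>, and the equation \<open>A^2 + t * B = 0\<close> is solved
  explicitly by \<open>A = - t * c / a\<close>, that is, by the points \<open>f t\<close>, which
  tend to \<open>- b / a\<close> as \<open>t\<close> tends to 0.\<close>

lemma degenerate_islimpt: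
  assumes "a * d = b * c"
  shows "of_real (- b / a) islimpt limits"
  unfolding islimpt_eq_infinite_ball
proof (intro allI impI)
  fix e :: real assume "e > 0"
  define f where "f t = complex_of_real (- b / a - t * c / a\<^sup>2)" for t
  \<comment> \<open>The first bound keeps \<open>t < 4\<close>; the second keeps the distance
    \<open>t * c / a^2\<close> below \<open>e\<close>.\<close>
  define \<delta> where "\<delta> = min 4 (e * a\<^sup>2 / c)"
  have "\<delta> > 0" using pos \<open>e > 0\<close> by (simp add: \<delta>_def)
  then have "infinite {0<..<\<delta>}" by (rule infinite_Ioo)
  moreover have "inj f"
    using pos by (auto simp: inj_def f_def)
  ultimately have "infinite (f ` {0<..<\<delta>})"
    using finite_imageD inj_on_subset by blast
  then have "infinite (f ` {0<..<\<delta>} - {z. G z = 0})"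
    using finite_zeros_G by simp
  moreover have "f ` {0<..<\<delta>} - {z. G z = 0} \<subseteq> limits \<inter> ball (of_real (- b / a)) e"
  proof safe
    fix t assume t: "t \<in> {0<..<\<delta>}" "G (f t) \<noteq> 0"
    have d: "d = b * c / a" using assms pos by (simp add: field_simps)
    have A: "A (f t) = of_real (- t * c / a)"
      unfolding A_def f_def of_real_mult[symmetric] of_real_add[symmetric] of_real_eq_iff
      using pos by (simp add: field_simps power2_eq_square)
    have B: "B (f t) = of_real (- t * c\<^sup>2 / a\<^sup>2)"
      unfolding B_def f_def of_real_mult[symmetric] of_real_add[symmetric] of_real_eq_iff
      by (subst d) (use pos in \<open>simp add: field_simps power2_eq_square\<close>)
    show "f t \<in> limits"
    proof (rule circle_limit[of t])
      show "(A (f t))\<^sup>2 + complex_of_real t * B (f t) = 0"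
        by (simp add: A B power2_eq_square)
      show "B (f t) \<noteq> 0"
        unfolding B of_real_eq_0_iff using pos t by simp
    qed (use t in \<open>auto simp: \<delta>_def\<close>)
    have "dist (complex_of_real (- b / a)) (f t) = t * c / a\<^sup>2"
      unfolding f_def dist_of_real using t pos by (simp add: dist_real_def)
    also have "\<dots> < e" using t pos by (simp add: \<delta>_def field_simps)
    finally show "f t \<in> ball (of_real (- b / a)) e" by simp
  qed
  ultimately show "infinite (limits \<inter> ball (of_real (- b / a)) e)"
    using finite_subset by blast
qed

end

section \<open>The set of all limits of zeros\<close>

text \<open>For \<open>u = l1 / l2\<close> on the unit circle,
  \<open>(u + 1)^2 = (2 + 2 * Re u) * u\<close>, so \<open>t = 2 + 2 * Re u\<close> works. This is
  the converse of the parametrisation by \<open>\<phi>\<close> in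
  \<open>circle_limit\<close>.\<close>

lemma equimodular_sum_square:
  fixes l1 l2 :: complex
  assumes "norm l1 = norm l2"
  shows "\<exists>t. 0 \<le> t \<and> t \<le> 4 \<and> (l1 + l2)\<^sup>2 = of_real t * (l1 * l2)"
proof (cases "l2 = 0")
  case True
  then show ?thesis using assms by (intro exI[of _ 0]) simp
next
  case False
  define u where "u = l1 / l2"
  have "norm u = 1" using assms False by (simp add: u_def norm_divide)
  then have "u * cnj u = 1" by (simp add: complex_norm_square[symmetric])
  moreover have "cnj u = of_real (2 * Re u) - u" by (simp add: complex_eq_iff)
  ultimately have "u\<^sup>2 + 1 = of_real (2 * Re u) * u"
    by (simp add: power2_eq_square algebra_simps)
  then have *: "(u + 1)\<^sup>2 = of_real (2 + 2 * Re u) * u"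
    by (simp add: power2_eq_square algebra_simps)
  have "l1 = u * l2" using False by (simp add: u_def)
  then have "(l1 + l2)\<^sup>2 = (u + 1)\<^sup>2 * l2\<^sup>2" "l1 * l2 = u * l2\<^sup>2"
    by (simp_all add: power2_eq_square algebra_simps)
  then have "(l1 + l2)\<^sup>2 = of_real (2 + 2 * Re u) * (l1 * l2)"
    by (simp only: *) simp
  moreover have "\<bar>Re u\<bar> \<le> 1" using abs_Re_le_cmod[of u] \<open>norm u = 1\<close> by simp
  ultimately show ?thesis by (intro exI[of _ "2 + 2 * Re u"]) auto
qed

lemma complex_power2_eq_of_real:
  assumes "w\<^sup>2 = complex_of_real s" "s \<ge> 0"
  shows "w = of_real (sqrt s) \<or> w = - of_real (sqrt s)"
proof -
  have "w\<^sup>2 = (of_real (sqrt s))\<^sup>2"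
    using assms by (simp flip: of_real_power)
  then show ?thesis by (simp only: power2_eq_iff)
qed

context W_sequence
begin

text \<open>If \<open>B x = 0\<close>, the equation forces \<open>A x = 0\<close>; then
  \<open>x = - b / a\<close> and \<open>a * d = b * c\<close>, which is the degenerate case.\<close>

lemma islimpt_limits:
  assumes t: "0 \<le> t" "t \<le> 4" "(A x)\<^sup>2 + of_real t * B x = 0"
  shows "x islimpt limits"
proof (cases "B x = 0")
  case False
  with t show ?thesis by (rule circle_islimpt)
next
  case True
  with t have A: "A x = 0" by simp
  then have x: "x = of_real (- b / a)"
    using pos by (simp add: A_def field_simps eq_neg_iff_add_eq_0)
  have "complex_of_real (c * (- b / a) + d) = 0"
    using True by (simp add: B_def x)
  then have "c * (- b / a) + d = 0" by (simp only: of_real_eq_0_iff)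
  then have "a * d = b * c" using pos by (simp add: field_simps)
  then show ?thesis unfolding x by (rule degenerate_islimpt)
qed

text \<open>Order the characteristic roots by modulus. Equal moduli put \<open>x\<close> on the
  curve; otherwise a limit must be the smaller root, and the larger one is then
  \<open>A x - x\<close>, which explains the inequality in the second set.\<close>

lemma limits_eq:
  "limits = {z. \<exists>t. 0 \<le> t \<and> t \<le> 4 \<and> (A z)\<^sup>2 + of_real t * B z = 0} \<union>
            {z. G z = 0 \<and> norm z < norm (A z - z)}" (is "_ = ?E \<union> ?T")
proof (intro equalityI subsetI)
  fix x assume x: "x \<in> limits"
  define s where "s = csqrt ((A x)\<^sup>2 + 4 * B x)"
  have s2: "s * s = (A x)\<^sup>2 + 4 * B x"
    by (simp add: s_def flip: power2_eq_square)
  have "((A x + s) / 2) * ((A x - s) / 2) = - B x"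
    using s2 by (simp add: field_simps power2_eq_square)
  moreover have "(A x + s) / 2 + (A x - s) / 2 = A x" by (simp add: field_simps)
  ultimately obtain l1 l2 where l: "l1 + l2 = A x" "l1 * l2 = - B x" "norm l2 \<le> norm l1"
    by (metis add.commute linear mult.commute)
  show "x \<in> ?E \<union> ?T"
  proof (cases "norm l2 = norm l1")
    case True
    then obtain t where t: "0 \<le> t" "t \<le> 4" "(l1 + l2)\<^sup>2 = of_real t * (l1 * l2)"
      using equimodular_sum_square by metis
    from t(3) have "(A x)\<^sup>2 + of_real t * B x = 0" by (simp add: l(1,2))
    with t(1,2) show ?thesis by blast
  next
    case False
    with l(3) have less: "norm l2 < norm l1" by simp
    then have "x = l2" using limit_iff_dominated[OF l(1,2)] x by blast
    have "G x = 0"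
      using G_factor_roots[OF l(1,2)] \<open>x = l2\<close> by simp
    moreover have "A x - x = l1" using l(1) \<open>x = l2\<close> by (metis add_diff_cancel_right')
    ultimately show ?thesis using less \<open>x = l2\<close> by simp
  qed
next
  fix x assume "x \<in> ?E \<union> ?T"
  then show "x \<in> limits"
  proof
    assume "x \<in> ?E"
    then have "x islimpt limits" using islimpt_limits by blast
    then show ?thesis using closed_limits closed_limpt by blast
  next
    assume "x \<in> ?T"
    then show ?thesis
      using limit_iff_dominated[of "A x - x" x x]
      by (simp add: G_def power2_eq_square algebra_simps)
  qed
qed

lemma islimpt_special:
  "of_real (- b / a) islimpt limits"
  "x_Delta_plus a b c d islimpt limits" "x_Delta_minus a b c d islimpt limits"
proof -
  have "A (of_real (- b / a)) = 0"
    using pos by (simp add: A_def)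
  then show "of_real (- b / a) islimpt limits"
    by (intro islimpt_limits[of 0]) auto
  have "(A z)\<^sup>2 + of_real 4 * B z = of_real (a\<^sup>2) * (z - x_Delta_plus a b c d) * (z - x_Delta_minus a b c d)" for z
    unfolding x_Delta_roots[OF pos(1), symmetric]
    by (simp add: A_def B_def power2_eq_square algebra_simps)
  then show "x_Delta_plus a b c d islimpt limits" "x_Delta_minus a b c d islimpt limits"
    by (intro islimpt_limits[of 4]; simp)+
qed

section \<open>The curve as a real segment when \<open>a * d < b * c\<close>\<close>

lemma A_of_real: "A (of_real x) = of_real (a * x + b)"
  and B_of_real: "B (of_real x) = of_real (c * x + d)"
  and G_of_real: "G (of_real x) = of_real (x\<^sup>2 - (a * x + b) * x - (c * x + d))"
  by (simp_all add: A_def B_def G_def)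

lemma Delta_Delta_pos:
  assumes "a * d < b * c"
  shows "Delta_Delta a b c d > 0"
proof -
  have "a * (a * d) < a * (b * c)"
    using assms pos by simp
  moreover have "c\<^sup>2 > 0" using pos by simp
  ultimately show ?thesis by (simp add: Delta_Delta_def power2_eq_square algebra_simps)
qed

text \<open>From \<open>(b + c)^2 \<ge> 4 * b * c\<close> one gets
  \<open>Delta_g \<ge> 4 * (b * c - a * d) + 4 * d\<close>.\<close>

lemma Delta_g_pos:
  assumes "a * d < b * c"
  shows "Delta_g a b c d > 0"
proof -
  have "(b + c)\<^sup>2 - 4 * (b * c) = (b - c)\<^sup>2" by (simp add: power2_eq_square algebra_simps)
  then have "4 * (b * c) \<le> (b + c)\<^sup>2" by (metis diff_ge_0_iff_ge zero_le_power2)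
  with assms pos show ?thesis by (simp add: Delta_g_def algebra_simps)
qed

text \<open>Completing the square, \<open>a^2\<close> times the left-hand side of the inequality is
  \<open>(a^2 * x + a * b + 2 * c)^2 - 4 * Delta_Delta\<close>.\<close>

lemma of_real_in_segment_iff:
  assumes lt: "a * d < b * c"
  shows "of_real x \<in> closed_segment (x_Delta_minus a b c d) (x_Delta_plus a b c d) \<longleftrightarrow>
         (a * x + b)\<^sup>2 + 4 * (c * x + d) \<le> 0"
proof -
  let ?s = "sqrt (Delta_Delta a b c d)"
  have s: "?s > 0" "?s\<^sup>2 = Delta_Delta a b c d" using Delta_Delta_pos[OF lt] by simp_all
  have "(2 * ?s)\<^sup>2 = 4 * Delta_Delta a b c d"
    by (simp only: power_mult_distrib s(2)) simp
  then have "a\<^sup>2 * ((a * x + b)\<^sup>2 + 4 * (c * x + d)) = (a\<^sup>2 * x + a * b + 2 * c)\<^sup>2 - (2 * ?s)\<^sup>2"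
    by (simp only: Delta_Delta_def) (simp add: power2_eq_square algebra_simps)
  then have "(a * x + b)\<^sup>2 + 4 * (c * x + d) \<le> 0 \<longleftrightarrow> (a\<^sup>2 * x + a * b + 2 * c)\<^sup>2 \<le> (2 * ?s)\<^sup>2"
    using pos by (metis diff_le_0_iff_le mult_le_0_iff not_less zero_less_power zero_le_power2 order_antisym_conv)
  also have "\<dots> \<longleftrightarrow> \<bar>a\<^sup>2 * x + a * b + 2 * c\<bar> \<le> 2 * ?s"
    by (simp only: abs_le_square_iff[symmetric] abs_mult abs_numeral abs_of_pos[OF s(1)])
  also have "\<dots> \<longleftrightarrow> (- a * b - 2 * c - 2 * ?s) / a\<^sup>2 \<le> x \<and> x \<le> (- a * b - 2 * c + 2 * ?s) / a\<^sup>2"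
    using pos by (auto simp: pos_divide_le_eq pos_le_divide_eq abs_le_iff mult.commute)
  finally show ?thesis
    unfolding closed_segment_x_Delta[OF pos lt] by auto
qed

text \<open>The discriminant of \<open>A^2 + t * B\<close> in \<open>z\<close> is non-negative for
  \<open>t \<ge> 0\<close>, so the curve is real. On it \<open>A^2 + 4 * B = (4 - t) * B\<close>,
  and the sign of \<open>B\<close> decides membership in the segment.\<close>

lemma circle_eq_segment:
  assumes lt: "a * d < b * c"
  shows "{z. \<exists>t. 0 \<le> t \<and> t \<le> 4 \<and> (A z)\<^sup>2 + of_real t * B z = 0} =
         closed_segment (x_Delta_minus a b c d) (x_Delta_plus a b c d)"
proof (intro equalityI subsetI)
  fix z assume "z \<in> {z. \<exists>t. 0 \<le> t \<and> t \<le> 4 \<and> (A z)\<^sup>2 + of_real t * B z = 0}"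
  then obtain t where t: "0 \<le> t" "t \<le> 4" "(A z)\<^sup>2 + of_real t * B z = 0" by blast
  \<comment> \<open>Completed square: \<open>w^2\<close> differs from
    \<open>4 * a^2 * ((A z)^2 + t * B z)\<close> by a real constant that is non-negative because
    \<open>a * d < b * c\<close>.\<close>
  define w where "w = of_real (2 * a\<^sup>2) * z + of_real (2 * a * b + t * c)"
  have "w\<^sup>2 = of_real (4 * a\<^sup>2) * ((A z)\<^sup>2 + of_real t * B z) + of_real (t * (4 * a * (b * c - a * d) + t * c\<^sup>2))"
    by (simp add: w_def A_def B_def power2_eq_square algebra_simps)
  then have w2: "w\<^sup>2 = of_real (t * (4 * a * (b * c - a * d) + t * c\<^sup>2))" by (simp add: t(3))
  have "t * (4 * a * (b * c - a * d) + t * c\<^sup>2) \<ge> 0"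
    using t(1) pos lt by simp
  from complex_power2_eq_of_real[OF w2 this] obtain v where v: "w = of_real v"
    by (metis of_real_minus)
  have "of_real (2 * a\<^sup>2) * z = of_real (v - (2 * a * b + t * c))"
    using v by (simp add: w_def algebra_simps)
  then have "z = of_real ((v - (2 * a * b + t * c)) / (2 * a\<^sup>2))"
    using pos by (simp add: field_simps)
  then obtain x where x: "z = of_real x" by blast
  have eq: "(a * x + b)\<^sup>2 + t * (c * x + d) = 0"
    using t(3) unfolding x A_of_real B_of_real by (simp only: of_real_power[symmetric] of_real_mult[symmetric] of_real_add[symmetric] of_real_eq_0_iff)
  have "(a * x + b)\<^sup>2 + 4 * (c * x + d) \<le> 0"
  \<comment> \<open>For \<open>t = 0\<close> the equation says nothing about the sign of
    \<open>B\<close>; but then \<open>x = - b / a\<close>, where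
    \<open>B = (a * d - b * c) / a\<close> is negative.\<close>
  proof (cases "t = 0")
    case True
    with eq have "a * x + b = 0" by simp
    then have "a * x = - b" by simp
    moreover have "a * (c * x + d) = c * (a * x) + a * d" by (simp add: algebra_simps)
    ultimately have "a * (c * x + d) < 0" using lt by (simp add: mult.commute)
    then have "c * x + d < 0" using pos by (simp add: mult_less_0_iff)
    with \<open>a * x + b = 0\<close> show ?thesis by simp
  next
    case False
    then have "t > 0" using t by simp
    moreover have "t * (c * x + d) \<le> 0" using eq zero_le_power2[of "a * x + b"] by linarith
    ultimately have "c * x + d \<le> 0" by (simp add: mult_le_0_iff)
    then have "(4 - t) * (c * x + d) \<le> 0" using t(2) by (simp add: mult_nonneg_nonpos)
    with eq show ?thesis by (simp add: algebra_simps)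
  qed
  then show "z \<in> closed_segment (x_Delta_minus a b c d) (x_Delta_plus a b c d)"
    unfolding x of_real_in_segment_iff[OF lt] .
next
  fix z assume z: "z \<in> closed_segment (x_Delta_minus a b c d) (x_Delta_plus a b c d)"
  then obtain x where x: "z = of_real x"
    unfolding closed_segment_x_Delta[OF pos lt] by blast
  have le: "(a * x + b)\<^sup>2 + 4 * (c * x + d) \<le> 0"
    using z of_real_in_segment_iff[OF lt] x by simp
  have "c * x + d \<noteq> 0"
  proof
    assume 0: "c * x + d = 0"
    with le have "a * x + b = 0" by simp
    then have "x = - b / a" using pos by (simp add: field_simps)
    with 0 lt pos show False by (simp add: field_simps)
  qed
  moreover have "4 * (c * x + d) \<le> 0" by (rule order_trans[OF _ le]) simp
  ultimately have neg: "c * x + d < 0" by simp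
  define t where "t = - ((a * x + b)\<^sup>2 / (c * x + d))"
  have "0 \<le> t" using neg by (simp add: t_def divide_nonneg_neg divide_nonneg_nonpos)
  moreover have "t \<le> 4" using neg le by (simp add: t_def field_simps)
  moreover have eq: "(a * x + b)\<^sup>2 + t * (c * x + d) = 0" using neg by (simp add: t_def)
  moreover have "(A z)\<^sup>2 + of_real t * B z = of_real ((a * x + b)\<^sup>2 + t * (c * x + d))"
    by (simp add: x A_of_real B_of_real)
  ultimately show "z \<in> {z. \<exists>t. 0 \<le> t \<and> t \<le> 4 \<and> (A z)\<^sup>2 + of_real t * B z = 0}"
    by auto
qed


section \<open>The zeros of \<open>G\<close> and the dominance condition\<close>

text \<open>This is the quadratic formula, or a linear equation if \<open>a = 1\<close>. The
  absolute value in the definitions of \<open>x_g_plus\<close> and \<open>x_g_minus\<close> only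
  interchanges the two roots when \<open>a > 1\<close>.\<close>

lemma G_eq_0_iff:
  assumes lt: "a * d < b * c"
  shows "G z = 0 \<longleftrightarrow> z = x_g_plus a b c d \<or> z = x_g_minus a b c d"
proof (cases "a = 1")
  case True
  have "G z = of_real (1 - a) * z\<^sup>2 - (of_real (b + c) * z + of_real d)"
    by (simp add: G_def A_def B_def power2_eq_square algebra_simps)
  then have "G z = - (of_real (b + c) * z + of_real d)"
    using True by simp
  moreover have "of_real (b + c) \<noteq> (0 :: complex)" using pos unfolding of_real_eq_0_iff by simp
  ultimately have "G z = 0 \<longleftrightarrow> z = - of_real d / of_real (b + c)"
    by (metis eq_neg_iff_add_eq_0 mult.commute neg_equal_0_iff_equal nonzero_eq_divide_eq)
  with True show ?thesis by (simp add: x_g_plus_def x_g_minus_def)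
next
  case False
  define s where "s = sqrt (Delta_g a b c d)"
  have s: "s\<^sup>2 = Delta_g a b c d" "csqrt (of_real (Delta_g a b c d)) = of_real s"
    using Delta_g_pos[OF lt] by (simp_all add: s_def)
  have ne: "of_real (1 - a) \<noteq> (0 :: complex)" unfolding of_real_eq_0_iff using False by simp
  have "of_real (4 * (1 - a)) * G z = (of_real (2 * (1 - a)) * z - of_real (b + c))\<^sup>2 - of_real (Delta_g a b c d)"
    by (simp add: G_def A_def B_def Delta_g_def power2_eq_square algebra_simps)
  also have "\<dots> = (of_real (2 * (1 - a)) * z - of_real (b + c))\<^sup>2 - (of_real s)\<^sup>2"
    by (simp flip: s(1))
  finally have "G z = 0 \<longleftrightarrow> (of_real (2 * (1 - a)) * z - of_real (b + c))\<^sup>2 = (of_real s)\<^sup>2"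
    using ne by (metis eq_iff_diff_eq_0 mult_eq_0_iff of_real_mult zero_neq_numeral of_real_numeral)
  also have "\<dots> \<longleftrightarrow> of_real (2 * (1 - a)) * z = of_real (b + c + s) \<or> of_real (2 * (1 - a)) * z = of_real (b + c - s)"
    unfolding power2_eq_iff by (auto simp: algebra_simps)
  also have "\<dots> \<longleftrightarrow> z = of_real ((b + c + s) / (2 * (1 - a))) \<or> z = of_real ((b + c - s) / (2 * (1 - a)))"
    using ne by (auto simp: field_simps)
  also have "\<dots> \<longleftrightarrow> z = x_g_plus a b c d \<or> z = x_g_minus a b c d"
  proof (cases "a < 1")
    case True
    then have "x_g_plus a b c d = of_real ((b + c + s) / (2 * (1 - a)))"
      "x_g_minus a b c d = of_real ((b + c - s) / (2 * (1 - a)))"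
      by (simp_all add: x_g_plus_def x_g_minus_def s add_divide_distrib diff_divide_distrib)
    then show ?thesis by simp
  next
    case False
    then have "\<bar>1 - a\<bar> = - (1 - a)" by simp
    then have abs: "complex_of_real s / of_real (2 * \<bar>1 - a\<bar>) = - (of_real s / of_real (2 * (1 - a)))"
      by (simp only: mult_minus_right of_real_minus divide_minus_right)
    have "x_g_plus a b c d = of_real ((b + c - s) / (2 * (1 - a)))"
      "x_g_minus a b c d = of_real ((b + c + s) / (2 * (1 - a)))"
      using \<open>a \<noteq> 1\<close>
      unfolding x_g_plus_def x_g_minus_def s abs by (simp_all add: add_divide_distrib diff_divide_distrib)
    then show ?thesis by auto
  qed
  finally show ?thesis .
qed

text \<open>Squaring both sides and factoring the difference of squares replaces moduli by the signs
  of two linear functions.\<close>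

lemma dominated_iff:
  assumes "G (of_real x) = 0"
  shows "norm (complex_of_real x) < norm (A (of_real x) - of_real x) \<longleftrightarrow>
         0 < (a * x + b) * (a * x + b - 2 * x)"
proof -
  have "norm (complex_of_real x) < norm (A (of_real x) - of_real x) \<longleftrightarrow> \<bar>x\<bar> < \<bar>a * x + b - x\<bar>"
    unfolding A_of_real of_real_diff[symmetric] norm_of_real ..
  also have "\<dots> \<longleftrightarrow> x\<^sup>2 < (a * x + b - x)\<^sup>2"
    unfolding not_le[symmetric] abs_le_square_iff ..
  also have "\<dots> \<longleftrightarrow> 0 < (a * x + b) * (a * x + b - 2 * x)"
    by (simp add: power2_eq_square algebra_simps)
  finally show ?thesis .
qed

text \<open>Verified through the sum and product of the roots. The factorisation lets the sign of
  \<open>G\<close> at a real point locate that point relative to \<open>m\<close> and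
  \<open>p\<close>.\<close>

lemma x_g_real:
  assumes lt: "a * d < b * c" and "a \<noteq> 1"
  obtains p m where "x_g_plus a b c d = of_real p" "x_g_minus a b c d = of_real m" "m < p"
    "\<And>y. y\<^sup>2 - (a * y + b) * y - (c * y + d) = (1 - a) * (y - p) * (y - m)"
proof -
  define s where "s = sqrt (Delta_g a b c d)"
  have s: "s\<^sup>2 = Delta_g a b c d" "csqrt (of_real (Delta_g a b c d)) = of_real s" "s > 0"
    using Delta_g_pos[OF lt] by (simp_all add: s_def)
  define u v p m where "u = (b + c) / (2 * (1 - a))" and "v = s / (2 * \<bar>1 - a\<bar>)"
    and "p = u + v" and "m = u - v"
  have "x_g_plus a b c d = of_real p" "x_g_minus a b c d = of_real m"
    using \<open>a \<noteq> 1\<close> by (simp_all add: x_g_plus_def x_g_minus_def s p_def m_def u_def v_def)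
  moreover have "m < p" using s(3) \<open>a \<noteq> 1\<close> by (simp add: p_def m_def v_def)
  moreover have "y\<^sup>2 - (a * y + b) * y - (c * y + d) = (1 - a) * (y - p) * (y - m)" for y
  proof -
    have u: "2 * (1 - a) * u = b + c" using \<open>a \<noteq> 1\<close> by (simp add: u_def)
    have "(2 * (1 - a))\<^sup>2 * v\<^sup>2 = (2 * \<bar>1 - a\<bar>)\<^sup>2 * v\<^sup>2"
      by (simp only: power_mult_distrib power2_abs)
    also have "\<dots> = (2 * \<bar>1 - a\<bar> * v)\<^sup>2"
      by (simp only: power_mult_distrib)
    also have "2 * \<bar>1 - a\<bar> * v = s" using \<open>a \<noteq> 1\<close> by (simp add: v_def)
    finally have v: "(2 * (1 - a))\<^sup>2 * v\<^sup>2 = s\<^sup>2" .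
    have "(1 - a) * (p + m) = b + c"
      unfolding u[symmetric] by (simp add: p_def m_def)
    moreover have "(1 - a) * (p * m) = - d"
    proof -
      have "4 * (1 - a) * ((1 - a) * (p * m)) = (2 * (1 - a) * u)\<^sup>2 - (2 * (1 - a))\<^sup>2 * v\<^sup>2"
        by (simp add: p_def m_def power2_eq_square algebra_simps)
      also have "\<dots> = 4 * (1 - a) * - d"
        unfolding u v s(1) Delta_g_def by (simp add: algebra_simps)
      finally show ?thesis using \<open>a \<noteq> 1\<close> by (subst (asm) mult_left_cancel) auto
    qed
    moreover have "(1 - a) * (y - p) * (y - m) = (1 - a) * y\<^sup>2 - (1 - a) * (p + m) * y + (1 - a) * (p * m)"
      by (simp add: power2_eq_square algebra_simps)
    ultimately have "(1 - a) * (y - p) * (y - m) = (1 - a) * y\<^sup>2 - (b + c) * y + - d"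
      by (simp only:)
    then show ?thesis by (simp add: power2_eq_square algebra_simps)
  qed
  ultimately show ?thesis using that by blast
qed

text \<open>At \<open>- b / a\<close>, the zero of \<open>A\<close>, \<open>G\<close> is positive
  because \<open>B\<close> is negative there. This places \<open>- b / a\<close> relative to
  \<open>m\<close> and \<open>p\<close> and hence gives the signs of \<open>A\<close> at
  \<open>m\<close> and \<open>p\<close>: \<open>- b / a < m < 0 < p\<close> if \<open>a < 1\<close>,
  and \<open>m < - b / a < p < 0\<close> if \<open>a > 1\<close>.\<close>

lemma dominated_zeros_eq:
  assumes lt: "a * d < b * c"
  shows "{z. G z = 0 \<and> norm z < norm (A z - z)} =
    (if a \<le> 1 then {x_g_minus a b c d}
     else if a \<le> 2 \<or> Delta_Delta a b c d \<le> Delta_g a b c d then {x_g_plus a b c d}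
     else {x_g_minus a b c d, x_g_plus a b c d})"
proof (cases "a = 1")
  case True
  define x where "x = - d / (b + c)"
  have x: "x_g_plus a b c d = of_real x" "x_g_minus a b c d = of_real x"
    using True by (simp_all add: x_g_plus_def x_g_minus_def x_def)
  have "x < 0" using pos by (simp add: x_def divide_neg_pos)
  have "b * (b + c) - d > 0" using lt pos True
    by (simp add: distrib_left) (meson add_strict_increasing less_imp_le less_trans mult_pos_pos)
  then have "x + b > 0" using pos by (simp add: x_def field_simps)
  then have "0 < (a * x + b) * (a * x + b - 2 * x)"
    using \<open>x < 0\<close> True by simp
  then show ?thesis
    using True dominated_iff[of x] G_eq_0_iff[OF lt] x by auto
next
  case False
  obtain p m where p: "x_g_plus a b c d = of_real p" and m: "x_g_minus a b c d = of_real m" and "m < p"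
    and factor: "\<And>y. y\<^sup>2 - (a * y + b) * y - (c * y + d) = (1 - a) * (y - p) * (y - m)"
    using x_g_real[OF lt False] by metis
  have G0: "G (of_real p) = 0" "G (of_real m) = 0"
    by (simp_all add: G_of_real factor)
  define T where "T = {z. G z = 0 \<and> norm z < norm (A z - z)}"
  have mem: "of_real p \<in> T \<longleftrightarrow> 0 < (a * p + b) * (a * p + b - 2 * p)"
       "of_real m \<in> T \<longleftrightarrow> 0 < (a * m + b) * (a * m + b - 2 * m)"
    unfolding T_def mem_Collect_eq using dominated_iff[OF G0(1)] dominated_iff[OF G0(2)] G0 by blast+
  have sub: "T \<subseteq> {of_real p, of_real m}"
    unfolding T_def using G_eq_0_iff[OF lt] p m by auto
  have "a * (c * (- b / a) + d) = a * d - b * c" using pos by (simp add: field_simps)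
  then have "a * (c * (- b / a) + d) < 0" using lt by simp
  then have "c * (- b / a) + d < 0" using pos by (simp add: mult_less_0_iff)
  then have "0 < (- b / a)\<^sup>2 - (a * (- b / a) + b) * (- b / a) - (c * (- b / a) + d)"
  proof -
    have "a * (- b / a) + b = 0" using pos by simp
    then show ?thesis
      using \<open>c * (- b / a) + d < 0\<close> zero_le_power2[of "- b / a"] by (simp only: mult_zero_left)
  qed
  then have at_centre: "0 < (1 - a) * (- b / a - p) * (- b / a - m)"
    by (simp only: factor)
  show ?thesis
    unfolding T_def[symmetric] p m
  proof (cases "a < 1")
    case True
    \<comment> \<open>The value of \<open>G\<close> at 0 is \<open>- d < 0\<close>, so the two zeros
      have opposite signs.\<close>
    have "(1 - a) * (0 - p) * (0 - m) < 0" unfolding factor[symmetric] using pos by simp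
    then have "p * m < 0" using True by (simp add: mult.assoc mult_less_0_iff)
    then have "m < 0" "p > 0" using \<open>m < p\<close> by (auto simp: mult_less_0_iff)
    have "- b / a < 0" using pos by simp
    with \<open>p > 0\<close> have "- b / a - p < 0" by linarith
    then have "- b / a < m"
      using at_centre True by (auto simp: zero_less_mult_iff)
    then have "a * m + b > 0" using pos by (simp add: field_simps)
    then have "0 < (a * m + b) * (a * m + b - 2 * m)" using \<open>m < 0\<close> by simp
    moreover have "\<not> 0 < (a * p + b) * (a * p + b - 2 * p)"
    proof -
      \<comment> \<open>\<open>G\<close> vanishes at \<open>p\<close>, so
        \<open>p * (p - A p) = B p > 0\<close>. Hence \<open>0 < A p < p\<close>, and
        \<open>A p - 2 * p\<close> is negative.\<close>
      have "p * (p - (a * p + b)) = c * p + d"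
        using factor[of p] by (simp add: power2_eq_square algebra_simps)
      moreover have "c * p + d > 0" "a * p + b > 0" using \<open>p > 0\<close> pos by (simp_all add: add_pos_pos)
      ultimately have "p - (a * p + b) > 0" using \<open>p > 0\<close> by (metis zero_less_mult_pos)
      then show ?thesis using \<open>p > 0\<close> \<open>a * p + b > 0\<close> by (simp add: zero_less_mult_iff)
    qed
    ultimately have "T = {of_real m}" using mem sub by blast
    with True show "T = (if a \<le> 1 then {of_real m}
        else if a \<le> 2 \<or> Delta_Delta a b c d \<le> Delta_g a b c d then {of_real p} else {of_real m, of_real p})"
      by simp
  next
    case False
    with \<open>a \<noteq> 1\<close> have "a > 1" by simp
    have neg: "0 < (1 - a) * (y - p) * (y - m) \<longleftrightarrow> m < y \<and> y < p" for y
      using \<open>a > 1\<close> \<open>m < p\<close> by (auto simp: zero_less_mult_iff mult_less_0_iff)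
    have centre: "m < - b / a" "- b / a < p" using at_centre neg by auto
    have A: "a * m + b < 0" "a * p + b > 0" using centre pos by (simp_all add: field_simps)
    have "p < 0"
    proof (rule ccontr)
      assume "\<not> p < 0"
      then have "(c * p + d) + (b + (a - 1) * p) * p > 0"
        using pos \<open>a > 1\<close> by (intro add_pos_nonneg[of "c * p + d"] add_nonneg_pos) auto
      then show False using factor[of p] by (simp add: power2_eq_square algebra_simps)
    qed
    then have "0 < (a * p + b) * (a * p + b - 2 * p)" using A by simp
    moreover have "0 < (a * m + b) * (a * m + b - 2 * m) \<longleftrightarrow> (a - 2) * m + b < 0"
      unfolding zero_less_mult_iff using A(1) by (auto simp: algebra_simps)
    moreover have "(a - 2) * m + b < 0 \<longleftrightarrow> a > 2 \<and> Delta_Delta a b c d > Delta_g a b c d"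
    proof (cases "a > 2")
      case True
      \<comment> \<open>The zero of \<open>A y - 2 * y\<close>. There \<open>(a - 2)^2 * G y\<close>
        equals \<open>Delta_Delta - Delta_g\<close>, so comparing the discriminants amounts to
        finding the sign of \<open>G y\<close>; as \<open>y < p\<close>, it is positive exactly when
        \<open>m < y\<close>.\<close>
      define y where "y = - b / (a - 2)"
      have y: "(a - 2) * y = - b" using True by (simp add: y_def)
      have "y < - b / a" using True pos by (simp add: y_def field_simps)
      then have "y < p" using centre by simp
      have "Delta_Delta a b c d - Delta_g a b c d =
          (1 - a) * ((a - 2) * y)\<^sup>2 - (b + c) * ((a - 2) * y) * (a - 2) - d * (a - 2)\<^sup>2"
        unfolding y Delta_Delta_def Delta_g_def by (simp add: power2_eq_square algebra_simps)
      also have "\<dots> = (a - 2)\<^sup>2 * (y\<^sup>2 - (a * y + b) * y - (c * y + d))"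
        by (simp add: power2_eq_square algebra_simps)
      finally have diff: "Delta_Delta a b c d - Delta_g a b c d = (a - 2)\<^sup>2 * ((1 - a) * (y - p) * (y - m))"
        unfolding factor .
      have "Delta_Delta a b c d > Delta_g a b c d \<longleftrightarrow> 0 < Delta_Delta a b c d - Delta_g a b c d"
        by simp
      also have "\<dots> \<longleftrightarrow> 0 < (1 - a) * (y - p) * (y - m)"
        unfolding diff using True by (subst zero_less_mult_iff) simp
      also have "\<dots> \<longleftrightarrow> m < y"
        using neg[of y] \<open>y < p\<close> by simp
      also have "\<dots> \<longleftrightarrow> (a - 2) * m + b < 0"
        using True by (simp add: y_def field_simps)
      finally show ?thesis using True by simp
    next
      case False
      then have "(a - 2) * m \<ge> 0" using \<open>m < p\<close> \<open>p < 0\<close> by (simp add: mult_nonpos_nonpos)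
      then show ?thesis using False pos by simp
    qed
    ultimately have "of_real p \<in> T" "of_real m \<in> T \<longleftrightarrow> a > 2 \<and> Delta_Delta a b c d > Delta_g a b c d"
      using mem by blast+
    with sub have "T = (if a \<le> 2 \<or> Delta_Delta a b c d \<le> Delta_g a b c d then {of_real p} else {of_real m, of_real p})"
      by (auto simp: not_le)
    with \<open>a > 1\<close> show "T = (if a \<le> 1 then {of_real m}
        else if a \<le> 2 \<or> Delta_Delta a b c d \<le> Delta_g a b c d then {of_real p} else {of_real m, of_real p})"
      by simp
  qed
qed

end

theorem theorem2p2:
  fixes a b c d :: real
  assumes "a > 0" "b > 0" "c > 0" "d > 0"
  shows "nonisolated_limit_of_zeros (W a b c d) (of_real (- b / a)) \<and>
         nonisolated_limit_of_zeros (W a b c d) (x_Delta_plus a b c d) \<and>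
         nonisolated_limit_of_zeros (W a b c d) (x_Delta_minus a b c d) \<and>
         (a * d < b * c \<longrightarrow> limits_of_zeros (W a b c d) = L_star a b c d)"
proof -
  interpret W_sequence a b c d using assms by unfold_locales
  have "limits_of_zeros (W a b c d) = L_star a b c d" if lt: "a * d < b * c"
    unfolding limits_eq circle_eq_segment[OF lt] dominated_zeros_eq[OF lt] L_star_def
    using assms by (intro arg_cong2[of _ _ _ _ "(\<union>)"]) auto
  then show ?thesis
    using islimpt_special[THEN nonisolatedI] by blast
qed

end
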